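(* Let $\psi$ be any nontrivial additive character of $\mathbb{F}_q$, $q=2^r$. Then for $n=1,3,5,\dots$, $$\sum_{w\in DC^-(n,q)}\psi(\mathrm{Tr}\,w)=A^-(n,q)K(\psi;1),$$ and for $n=2,4,6,\dots$, $$\sum_{w\in DC^+(n,q)}\psi(\mathrm{Tr}\,w)=q^{-1}A^+(n,q)K_{GL(2,q)}(\psi;1)=A^+(n,q)\big(K(\psi;1)^2+q^2-q\big).$$
   Context: $q=2^r$; $\mathrm{Tr}\,w$ is the matrix trace. $Sp(2n,q)=\{w\in GL(2n,\mathbb{F}_q):{}^twJw=J\}$, $J=\begin{pmatrix}0&1_n\\1_n&0\end{pmatrix}$. $P=P(2n,q)$ is the subgroup of all $\begin{pmatrix}A&0\\0&{}^tA^{-1}\end{pmatrix}\begin{pmatrix}1_n&B\\0&1_n\end{pmatrix}$, $A\in GL(n,\mathbb{F}_q)$, $B$ symmetric $n\times n$ over $\mathbb{F}_q$. For $0\le s\le n$, $\sigma_s=\begin{pmatrix}0&0&1_s&0\\0&1_{n-s}&0&0\\1_s&0&0&0\\0&0&0&1_{n-s}\end{pmatrix}$ (block sizes $s,n-s,s,n-s$). For odd $n$, $DC^-(n,q)=P\sigma_{n-1}P$; for even $n$, $DC^+(n,q)=P\sigma_{n-2}P$. $\left[\begin{smallmatrix}n\\ s\end{smallmatrix}\right]_q=\prod_{j=0}^{s-1}\frac{q^{n-j}-1}{q^{s-j}-1}$. $A^-(n,q)=q^{\frac14(5n^2-1)}\left[\begin{smallmatrix}n\\1\end{smallmatrix}\right]_q\prod_{j=1}^{(n-1)/2}(q^{2j-1}-1)$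 for $n$ odd; $A^+(n,q)=q^{\frac14(5n^2-2n)}\left[\begin{smallmatrix}n\\2\end{smallmatrix}\right]_q\prod_{j=1}^{(n-2)/2}(q^{2j-1}-1)$ for $n$ even (empty products $=1$). $K(\psi;a)=\sum_{\alpha\in\mathbb{F}_q^*}\psi(\alpha+a\alpha^{-1})$, and $K_{GL(2,q)}(\psi;a)=\sum_{w\in GL(2,\mathbb{F}_q)}\psi(\mathrm{Tr}\,w+a\,\mathrm{Tr}\,w^{-1})$. *)

theory Defs
  imports Complex_Main "HOL-Library.Cardinality" "Jordan_Normal_Form.Matrix"
begin

definition mat_trace :: "'a::comm_monoid_add mat \<Rightarrow> 'a" where
  "mat_trace A = (\<Sum>i<dim_row A. A $$ (i, i))"

definition GL :: "nat \<Rightarrow> 'a::field mat set" where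
  "GL n = Units (ring_mat TYPE('a) n ())"

definition GL_inv :: "nat \<Rightarrow> 'a::field mat \<Rightarrow> 'a mat" where
  "GL_inv n A = inv\<^bsub>ring_mat TYPE('a) n ()\<^esub> A"

(* The maximal parabolic subgroup P(2n,q) of Sp(2n,q), for the form with
   Gram matrix J = (0, 1; 1, 0). *)
definition parabolic :: "nat \<Rightarrow> 'a::field mat set" where
  "parabolic n =
     {four_block_mat A (0\<^sub>m n n) (0\<^sub>m n n) (transpose_mat (GL_inv n A)) *
      four_block_mat (1\<^sub>m n) B (0\<^sub>m n n) (1\<^sub>m n) | A B.
      A \<in> GL n \<and> B \<in> carrier_mat n n \<and> transpose_mat B = B}"

(* The block sizes are (s, n-s, s, n-s), grouped into four n x n blocks; only s <= n is meant. *)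
definition sigma :: "nat \<Rightarrow> nat \<Rightarrow> 'a::field mat" where
  "sigma n s =
     (let E = four_block_mat (1\<^sub>m s) (0\<^sub>m s (n - s)) (0\<^sub>m (n - s) s) (0\<^sub>m (n - s) (n - s));
          F = four_block_mat (0\<^sub>m s s) (0\<^sub>m s (n - s)) (0\<^sub>m (n - s) s) (1\<^sub>m (n - s))
      in four_block_mat F E E F)"

definition double_coset :: "nat \<Rightarrow> nat \<Rightarrow> 'a::field mat set" where
  "double_coset n s = {p * sigma n s * p' | p p'. p \<in> parabolic n \<and> p' \<in> parabolic n}"

definition DC_minus :: "nat \<Rightarrow> 'a::field mat set" where
  "DC_minus n = double_coset n (n - 1)"

definition DC_plus :: "nat \<Rightarrow> 'a::field mat set" where
  "DC_plus n = double_coset n (n - 2)"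

definition gauss_binomial :: "nat \<Rightarrow> nat \<Rightarrow> nat \<Rightarrow> real" where
  "gauss_binomial q n s = (\<Prod>j<s. (real q ^ (n - j) - 1) / (real q ^ (s - j) - 1))"

(* A_minus is meant for odd n and A_plus for even n; all the divisions in the exponents and
   product bounds are then exact. *)
definition A_minus :: "nat \<Rightarrow> nat \<Rightarrow> real" where
  "A_minus n q = real q ^ ((5 * n\<^sup>2 - 1) div 4) * gauss_binomial q n 1 *
     (\<Prod>j=1..(n - 1) div 2. real q ^ (2 * j - 1) - 1)"

definition A_plus :: "nat \<Rightarrow> nat \<Rightarrow> real" where
  "A_plus n q = real q ^ ((5 * n\<^sup>2 - 2 * n) div 4) * gauss_binomial q n 2 *
     (\<Prod>j=1..(n - 2) div 2. real q ^ (2 * j - 1) - 1)"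

definition additive_character :: "('a::field \<Rightarrow> complex) \<Rightarrow> bool" where
  "additive_character \<psi> \<longleftrightarrow> (\<forall>x. \<psi> x \<noteq> 0) \<and> (\<forall>x y. \<psi> (x + y) = \<psi> x * \<psi> y)"

definition nontrivial_character :: "('a::field \<Rightarrow> complex) \<Rightarrow> bool" where
  "nontrivial_character \<psi> \<longleftrightarrow> (\<exists>x. \<psi> x \<noteq> 1)"

definition kloosterman :: "('a::{field,finite} \<Rightarrow> complex) \<Rightarrow> 'a \<Rightarrow> complex" where
  "kloosterman \<psi> a = (\<Sum>\<alpha>\<in>UNIV - {0}. \<psi> (\<alpha> + a * inverse \<alpha>))"

definition kloosterman_GL :: "nat \<Rightarrow> ('a::{field,finite} \<Rightarrow> complex) \<Rightarrow> 'a \<Rightarrow> complex" where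
  "kloosterman_GL n \<psi> a = (\<Sum>w\<in>GL n. \<psi> (mat_trace w + a * mat_trace (GL_inv n w)))"

end

theory Submission
  imports Defs "Jordan_Normal_Form.Determinant" "HOL-Library.FuncSet"
begin

text \<open>Write \<open>P\<close> for the parabolic subgroup and \<open>\<sigma> = sigma n s\<close>, an involution. As the trace is invariant under
  conjugation, the pairs in \<open>P \<times> P\<close> give \<open>|P \<inter> \<sigma>P\<sigma>|\<close> times the sum over \<open>P\<sigma>P\<close> as \<open>|P|\<close> times the sum
  over \<open>P\<sigma>\<close>. In the latter, summing over the symmetric matrix \<open>B\<close> first kills every \<open>A\<close> except those
  whose first \<open>s\<close> rows form an alternating matrix followed by zeros. These are block lower triangular,
  and what remains is the number of nonsingular alternating \<open>s \<times> s\<close> matrices times the Kloosterman sum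
  over \<open>GL(n - s, q)\<close>. Both \<open>|GL(n, q)|\<close> and the number of alternating matrices satisfy recursions obtained by
  moving the last column to a unit vector. For \<open>GL(2, q)\<close> one fixes the diagonal \<open>(a, d)\<close>: if \<open>b \<noteq> 0\<close> then
  \<open>ad - bc\<close> runs over the whole field with \<open>c\<close>, and \<open>b = 0\<close> contributes \<open>q\<close> times the square of the classical
  sum.\<close>

text \<open>The matrix \<open>B\<close> enters the trace on \<open>P\<close> times
  \<open>sigma\<close> only through \<open>Tr (E A B)\<close>, with \<open>E\<close> the projection
  to the first \<open>s\<close> coordinates, and the functional \<open>Tr (M B)\<close> vanishes on
  all symmetric \<open>B\<close> exactly when \<open>M\<close> is alternating; hence the condition
  on the rows of \<open>A\<close>. Nonsingular alternating matrices exist only in even order, which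
  explains \<open>s = n - 1\<close> for odd \<open>n\<close> and \<open>s = n - 2\<close> for even
  \<open>n\<close>, and why only GL(1) and GL(2) remain. The obstacle is characteristic two:
  antisymmetry does not give a zero diagonal there, so the diagonal is carried as a condition of its
  own. The same characteristic makes the intersection of \<open>P\<close> with its conjugate easy to
  find: \<open>P\<close> consists of the isometries of the sign-free form \<open>J\<close> whose
  lower left block is zero, and \<open>sigma\<close> is an isometry, so a conjugate lies in
  \<open>P\<close> as soon as that one block vanishes.\<close>

lemma GL_carrier: "A \<in> GL n \<Longrightarrow> A \<in> carrier_mat n n"
  by (auto simp: GL_def Units_def ring_mat_simps)

lemma GL_iff_det: "A \<in> GL n \<longleftrightarrow> A \<in> carrier_mat n n \<and> det A \<noteq> 0"
  using GL_carrier[of A n] det_non_zero_imp_unit[of A n "()"] unit_imp_det_non_zero[of A n "()"]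
  by (auto simp: GL_def)

lemma GL_inv:
  fixes A :: "'a::field mat"
  assumes "A \<in> GL n"
  shows "GL_inv n A \<in> carrier_mat n n" "A * GL_inv n A = 1\<^sub>m n" "GL_inv n A * A = 1\<^sub>m n"
    "GL_inv n A \<in> GL n"
proof -
  interpret ring "ring_mat TYPE('a) n ()" by (rule ring_mat)
  have A: "A \<in> Units (ring_mat TYPE('a) n ())" using assms by (simp add: GL_def)
  show "GL_inv n A \<in> GL n" using Units_inv_Units[OF A] by (simp add: GL_def GL_inv_def)
  then show "GL_inv n A \<in> carrier_mat n n" by (rule GL_carrier)
  show "A * GL_inv n A = 1\<^sub>m n" "GL_inv n A * A = 1\<^sub>m n"
    using Units_r_inv[OF A] Units_l_inv[OF A] by (simp_all add: GL_inv_def ring_mat_simps)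
qed

lemma GL_inv_cancel:
  fixes A B :: "'a::field mat"
  assumes "A \<in> GL n" "B \<in> carrier_mat n m"
  shows "GL_inv n A * (A * B) = B" "A * (GL_inv n A * B) = B"
  using assms GL_inv[OF assms(1)] GL_carrier[OF assms(1)]
  by (simp_all add: assoc_mult_mat[symmetric, of _ n n _ n _ m] del: assoc_mult_mat)

lemma GL_inv_eqI:
  fixes A B :: "'a::field mat"
  assumes A: "A \<in> carrier_mat n n" and B: "B \<in> carrier_mat n n" and AB: "A * B = 1\<^sub>m n"
  shows "A \<in> GL n" "GL_inv n A = B"
proof -
  have "det A * det B = 1" using det_mult[OF A B] AB by simp
  then show GL: "A \<in> GL n" using A by (auto simp: GL_iff_det)
  have "GL_inv n A = GL_inv n A * (A * B)" using GL_inv[OF GL] by (simp add: AB)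
  also have "\<dots> = B" using GL_inv[OF GL] A B by (simp add: assoc_mult_mat[symmetric, of _ n n _ n _ n])
  finally show "GL_inv n A = B" .
qed

lemma GL_mult: "A \<in> GL n \<Longrightarrow> B \<in> GL n \<Longrightarrow> A * B \<in> GL n"
  by (auto simp: GL_iff_det det_mult)

lemma GL_transpose: "A \<in> GL n \<Longrightarrow> transpose_mat A \<in> GL n"
  by (auto simp: GL_iff_det det_transpose)

lemma one_GL: "1\<^sub>m n \<in> GL n"
  by (simp add: GL_iff_det)

section \<open>Block matrices and traces\<close>

lemma four_block_mat_inject:
  assumes c: "A \<in> carrier_mat a c" "B \<in> carrier_mat a d" "C \<in> carrier_mat b c" "D \<in> carrier_mat b d"
    "A' \<in> carrier_mat a c" "B' \<in> carrier_mat a d" "C' \<in> carrier_mat b c" "D' \<in> carrier_mat b d"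
  shows "four_block_mat A B C D = four_block_mat A' B' C' D' \<longleftrightarrow> A = A' \<and> B = B' \<and> C = C' \<and> D = D'"
proof
  assume eq: "four_block_mat A B C D = four_block_mat A' B' C' D'"
  have e: "four_block_mat A B C D $$ (i, j) = four_block_mat A' B' C' D' $$ (i, j)" for i j
    by (simp add: eq)
  have "A $$ (i, j) = A' $$ (i, j)" if "i < a" "j < c" for i j
    using e[of i j] that c by simp
  moreover have "B $$ (i, j) = B' $$ (i, j)" if "i < a" "j < d" for i j
    using e[of i "c + j"] that c by simp
  moreover have "C $$ (i, j) = C' $$ (i, j)" if "i < b" "j < c" for i j
    using e[of "a + i" j] that c by simp
  moreover have "D $$ (i, j) = D' $$ (i, j)" if "i < b" "j < d" for i j
    using e[of "a + i" "c + j"] that c by simp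
  ultimately show "A = A' \<and> B = B' \<and> C = C' \<and> D = D'"
    using c by (auto intro!: eq_matI)
qed simp

lemma four_block_mat_exhaust:
  assumes "M \<in> carrier_mat (a + b) (c + d)"
  obtains A B C D where "A \<in> carrier_mat a c" "B \<in> carrier_mat a d" "C \<in> carrier_mat b c"
    "D \<in> carrier_mat b d" "M = four_block_mat A B C D"
proof -
  have "M = four_block_mat (mat a c (\<lambda>(i, j). M $$ (i, j))) (mat a d (\<lambda>(i, j). M $$ (i, j + c)))
    (mat b c (\<lambda>(i, j). M $$ (i + a, j))) (mat b d (\<lambda>(i, j). M $$ (i + a, j + c)))"
    using assms by (intro eq_matI) auto
  then show thesis by (rule that[OF mat_carrier mat_carrier mat_carrier mat_carrier])
qed

lemma trace_four_block_mat:
  fixes A :: "'a::comm_monoid_add mat"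
  assumes "A \<in> carrier_mat n n" "D \<in> carrier_mat m m"
  shows "mat_trace (four_block_mat A B C D) = mat_trace A + mat_trace D"
proof -
  have split: "(\<Sum>i<n + m. f i) = (\<Sum>i<n. f i) + (\<Sum>i<m. f (n + i))" for f :: "nat \<Rightarrow> 'a"
    by (induction m) (auto simp: add.assoc)
  show ?thesis
    using assms by (simp add: mat_trace_def split)
qed

lemma mat_trace_mult:
  assumes "A \<in> carrier_mat n m" "B \<in> carrier_mat m n"
  shows "mat_trace (A * B) = (\<Sum>i<n. \<Sum>j<m. A $$ (i, j) * B $$ (j, i))"
  using assms by (auto simp: mat_trace_def scalar_prod_def lessThan_atLeast0 intro!: sum.cong)

lemma mat_trace_comm:
  fixes A :: "'a::comm_semiring_0 mat"
  assumes "A \<in> carrier_mat n m" "B \<in> carrier_mat m n"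
  shows "mat_trace (A * B) = mat_trace (B * A)"
  unfolding mat_trace_mult[OF assms] mat_trace_mult[OF assms(2,1)]
  by (subst sum.swap) (simp add: mult.commute)

lemma mat_trace_add:
  "A \<in> carrier_mat n n \<Longrightarrow> B \<in> carrier_mat n n \<Longrightarrow> mat_trace (A + B) = mat_trace A + mat_trace B"
  by (simp add: mat_trace_def sum.distrib)

section \<open>Counting matrices and vectors\<close>

lemma card_carrier_mat:
  "finite (carrier_mat a b :: 'a::finite mat set)"
  "card (carrier_mat a b :: 'a mat set) = CARD('a) ^ (a * b)"
proof -
  let ?I = "{..<a} \<times> {..<b}"
  have b: "bij_betw (mat a b) (?I \<rightarrow>\<^sub>E (UNIV :: 'a set)) (carrier_mat a b)"
  proof (rule bij_betw_byWitness[where f' = "\<lambda>M. restrict (\<lambda>ij. M $$ ij) ?I"])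
    show "\<forall>f\<in>?I \<rightarrow>\<^sub>E UNIV. restrict (\<lambda>ij. mat a b f $$ ij) ?I = f"
      by (auto simp: fun_eq_iff PiE_def extensional_def restrict_def)
    show "\<forall>M\<in>carrier_mat a b. mat a b (restrict (\<lambda>ij. M $$ ij) ?I) = M"
      by (auto intro!: eq_matI)
  qed (auto simp: PiE_def extensional_def)
  show "finite (carrier_mat a b :: 'a mat set)"
    using bij_betw_finite[OF b] by (simp add: finite_PiE)
  show "card (carrier_mat a b :: 'a mat set) = CARD('a) ^ (a * b)"
    using bij_betw_same_card[OF b] by (simp add: card_PiE card_cartesian_product)
qed

lemma card_carrier_vec:
  "finite (carrier_vec n :: 'a::finite vec set)"
  "card (carrier_vec n :: 'a vec set) = CARD('a) ^ n"
proof -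
  have b: "bij_betw (\<lambda>M. col M 0) (carrier_mat n 1) (carrier_vec n :: 'a vec set)"
    by (rule bij_betw_byWitness[where f' = "\<lambda>v. mat n 1 (\<lambda>(i, j). v $ i)"])
      (auto intro!: eq_matI eq_vecI)
  show "finite (carrier_vec n :: 'a vec set)"
    using bij_betw_finite[OF b] card_carrier_mat(1)[of n 1, where ?'a = 'a] by simp
  show "card (carrier_vec n :: 'a vec set) = CARD('a) ^ n"
    using bij_betw_same_card[OF b] by (simp add: card_carrier_mat)
qed

lemma finite_GL: "finite (GL n :: 'a::{field,finite} mat set)"
  by (rule finite_subset[OF _ card_carrier_mat(1)[of n n]]) (auto simp: GL_carrier)

lemma card_equal_fibres:
  assumes "finite S" "finite V" "f ` S \<subseteq> V" "\<And>v. v \<in> V \<Longrightarrow> card {x \<in> S. f x = v} = c"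
  shows "card S = card V * c"
  using sum_fun_comp[OF assms(1-3), of "\<lambda>_. 1 :: nat"] assms(4) by simp

section \<open>Symmetric matrices\<close>

definition symm_mats :: "nat \<Rightarrow> 'a mat set" where
  "symm_mats n = {B \<in> carrier_mat n n. transpose_mat B = B}"

lemma finite_symm_mats: "finite (symm_mats n :: 'a::finite mat set)"
  by (rule finite_subset[OF _ card_carrier_mat(1)[of n n]]) (auto simp: symm_mats_def)

lemma symm_mats_block:
  assumes "A \<in> carrier_mat s s" "B \<in> carrier_mat s t" "C \<in> carrier_mat t s" "D \<in> carrier_mat t t"
  shows "four_block_mat A B C D \<in> symm_mats (s + t) \<longleftrightarrow>
    A \<in> symm_mats s \<and> C = transpose_mat B \<and> D \<in> symm_mats t"
proof -
  have "four_block_mat A B C D \<in> symm_mats (s + t) \<longleftrightarrow>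
    four_block_mat (transpose_mat A) (transpose_mat C) (transpose_mat B) (transpose_mat D) = four_block_mat A B C D"
    using assms by (simp add: symm_mats_def transpose_four_block_mat[OF assms])
  also have "\<dots> \<longleftrightarrow> transpose_mat A = A \<and> transpose_mat C = B \<and> transpose_mat B = C \<and> transpose_mat D = D"
    using assms by (intro four_block_mat_inject) auto
  also have "\<dots> \<longleftrightarrow> A \<in> symm_mats s \<and> C = transpose_mat B \<and> D \<in> symm_mats t"
    using assms by (auto simp: symm_mats_def)
  finally show ?thesis .
qed

text \<open>Serves the count of symmetric matrices and, with \<open>A\<close> fixed to zero, the
  count of the stabilizer of \<open>sigma\<close>.\<close>

lemma bij_betw_symm_mats_block:
  fixes s t :: nat
  shows "bij_betw (\<lambda>(A, B, D). four_block_mat A B (transpose_mat B) D)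
    (symm_mats s \<times> carrier_mat s t \<times> symm_mats t) (symm_mats (s + t) :: 'a mat set)"
  (is "bij_betw ?f ?X _")
proof (rule bij_betw_imageI)
  show "inj_on ?f ?X"
  proof (rule inj_onI)
    fix x y assume "x \<in> ?X" "y \<in> ?X" "?f x = ?f y"
    moreover obtain A B D A' B' D' where xy: "x = (A, B, D)" "y = (A', B', D')" by (metis prod_cases3)
    ultimately have "A \<in> symm_mats s" "A' \<in> symm_mats s" "D \<in> symm_mats t" "D' \<in> symm_mats t"
      and B: "B \<in> carrier_mat s t" "B' \<in> carrier_mat s t"
      and eq: "four_block_mat A B (transpose_mat B) D = four_block_mat A' B' (transpose_mat B') D'"
      by auto
    then have c: "A \<in> carrier_mat s s" "A' \<in> carrier_mat s s" "D \<in> carrier_mat t t" "D' \<in> carrier_mat t t"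
      "transpose_mat B \<in> carrier_mat t s" "transpose_mat B' \<in> carrier_mat t s"
      by (simp_all add: symm_mats_def)
    show "x = y"
      using four_block_mat_inject[OF c(1) B(1) c(5) c(3) c(2) B(2) c(6) c(4)] eq xy by blast
  qed
  show "?f ` ?X = symm_mats (s + t)"
  proof (intro equalityI subsetI)
    fix M assume "M \<in> ?f ` ?X"
    then obtain A B D where "A \<in> symm_mats s" "B \<in> carrier_mat s t" "D \<in> symm_mats t"
      "M = four_block_mat A B (transpose_mat B) D" by auto
    then show "M \<in> symm_mats (s + t)"
      using symm_mats_block[of A s B t "transpose_mat B" D] by (simp add: symm_mats_def)
  next
    fix M :: "'a mat" assume M: "M \<in> symm_mats (s + t)"
    then have "M \<in> carrier_mat (s + t) (s + t)" by (simp add: symm_mats_def)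
    then obtain A B C D where "A \<in> carrier_mat s s" "B \<in> carrier_mat s t" "C \<in> carrier_mat t s"
      "D \<in> carrier_mat t t" "M = four_block_mat A B C D"
      by (rule four_block_mat_exhaust)
    then show "M \<in> ?f ` ?X"
      using M symm_mats_block[of A s B t C D] by (intro image_eqI[of _ _ "(A, B, D)"]) auto
  qed
qed

lemma card_symm_mats_add:
  "card (symm_mats (s + t) :: 'a::finite mat set) =
    card (symm_mats s :: 'a mat set) * CARD('a) ^ (s * t) * card (symm_mats t :: 'a mat set)"
  using bij_betw_same_card[OF bij_betw_symm_mats_block[of s t, where ?'a = 'a]]
  by (simp add: card_cartesian_product card_carrier_mat)

lemma card_symm_mats: "card (symm_mats n :: 'a::finite mat set) = CARD('a) ^ (n * (n + 1) div 2)"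
proof (induction n)
  case 0
  have "symm_mats 0 = (carrier_mat 0 0 :: 'a mat set)" by (auto simp: symm_mats_def)
  then show ?case using card_carrier_mat(2)[of 0 0, where ?'a = 'a] by simp
next
  case (Suc n)
  have "symm_mats 1 = (carrier_mat 1 1 :: 'a mat set)" by (auto simp: symm_mats_def intro!: eq_matI)
  then have "card (symm_mats 1 :: 'a mat set) = CARD('a)" by (simp add: card_carrier_mat)
  moreover have "Suc n * (Suc n + 1) div 2 = n * (n + 1) div 2 + n + 1"
  proof -
    have "Suc n * (Suc n + 1) = n * (n + 1) + (n + 1) * 2" by (simp add: algebra_simps)
    then show ?thesis by simp
  qed
  ultimately show ?case
    using card_symm_mats_add[of n 1, where ?'a = 'a] Suc.IH by (simp add: power_add)
qed

section \<open>The order of the general linear group\<close>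

lemma mult_unit_vec:
  fixes A :: "'a::comm_semiring_1 mat"
  assumes "A \<in> carrier_mat n m" "j < m"
  shows "A *\<^sub>v unit_vec m j = col A j"
  using assms by (intro eq_vecI) (auto simp: scalar_prod_right_unit[of j m])

text \<open>The identity with its last column replaced by \<open>v\<close> is upper triangular with
  determinant \<open>v $ n\<close>, which settles \<open>v $ n \<noteq> 0\<close>. Otherwise a row
  operation produces the zero.\<close>

lemma exists_GL_last_col:
  fixes v :: "'a::field vec"
  assumes v: "v \<in> carrier_vec (Suc n)" "v \<noteq> 0\<^sub>v (Suc n)"
  obtains G where "G \<in> GL (Suc n)" "col G n = v"
proof -
  define G where "G w = mat (Suc n) (Suc n) (\<lambda>(i, j). if j = n then w $ i else if i = j then 1 else 0)" for w :: "'a vec"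
  have G: "G w \<in> carrier_mat (Suc n) (Suc n)" for w by (simp add: G_def)
  have "det (G w) = prod_list (diag_mat (G w))" for w
    by (rule det_upper_triangular[of _ "Suc n"]) (auto simp: G_def)
  also have "prod_list (diag_mat (G w)) = w $ n" for w
    by (auto simp: prod_list_diag_prod G_def)
  finally have det: "det (G w) = w $ n" for w .
  show thesis
  proof (cases "v $ n = 0")
    case False
    have "col (G v) n = v" using v by (intro eq_vecI) (auto simp: G_def)
    then show thesis using that[of "G v"] G det False by (simp add: GL_iff_det)
  next
    case True
    obtain k where k: "k < Suc n" "v $ k \<noteq> 0"
      using v by (metis (no_types) eq_vecI carrier_vecD index_zero_vec)
    \<comment> \<open>The zero at position \<open>n\<close> is replaced by the nonzero
      \<open>v $ k\<close>; subtracting row \<open>k\<close> from row \<open>n\<close> then restores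
      it without changing the determinant.\<close>
    define w where "w = vec (Suc n) (\<lambda>i. if i = n then v $ k else v $ i)"
    let ?H = "addrow (- 1) n k (G w)"
    have kn: "n \<noteq> k" using True k by auto
    have "det ?H = v $ k"
      using det_addrow[OF k(1) kn G] by (simp add: det w_def)
    moreover have "col ?H n = v"
      using v True k kn by (intro eq_vecI) (auto simp: G_def w_def)
    ultimately show thesis using that[of ?H] G k by (simp add: GL_iff_det)
  qed
qed

text \<open>The last column ranges over the nonzero vectors, and left multiplication by a matrix
  with last column \<open>v\<close> carries the fibre over the last unit vector to the fibre over
  \<open>v\<close>. The former consists of the matrices with blocks A, 0, C, 1 where the row C is
  arbitrary, whence the factor \<open>CARD('a) ^ n\<close>.\<close>

lemma card_GL_Suc:
  "card (GL (Suc n) :: 'a::{field,finite} mat set) =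
    (CARD('a) ^ Suc n - 1) * (CARD('a) ^ n * card (GL n :: 'a mat set))"
proof -
  let ?G = "GL (Suc n) :: 'a mat set"
  let ?V = "carrier_vec (Suc n) - {0\<^sub>v (Suc n)} :: 'a vec set"
  let ?e = "unit_vec (Suc n) n :: 'a vec"
  have nz: "A *\<^sub>v w \<noteq> 0\<^sub>v (Suc n)" if "A \<in> ?G" "w \<in> ?V" for A w
  proof
    assume "A *\<^sub>v w = 0\<^sub>v (Suc n)"
    then have "GL_inv (Suc n) A *\<^sub>v (A *\<^sub>v w) = 0\<^sub>v (Suc n)"
      using GL_inv(1)[OF that(1)] by auto
    moreover have "GL_inv (Suc n) A *\<^sub>v (A *\<^sub>v w) = (GL_inv (Suc n) A * A) *\<^sub>v w"
      using GL_inv(1)[OF that(1)] GL_carrier[OF that(1)] that(2)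
      by (intro assoc_mult_mat_vec[symmetric]) auto
    ultimately show False using GL_inv(3)[OF that(1)] that(2) by auto
  qed
  have e: "?e \<in> ?V"
    by (auto dest: arg_cong[of _ _ "\<lambda>v. v $ n"])
  have "card {A \<in> ?G. col A n = v} = card {A \<in> ?G. col A n = ?e}" if v: "v \<in> ?V" for v
  proof -
    obtain H where H: "H \<in> ?G" "col H n = v"
      using v by (auto elim: exists_GL_last_col[of v n])
    note c = GL_carrier[OF H(1)] GL_inv(1)[OF H(1)]
    have He: "H *\<^sub>v ?e = v" using c H by (simp add: mult_unit_vec)
    have Hv: "GL_inv (Suc n) H *\<^sub>v v = ?e"
      unfolding He[symmetric] using c GL_inv(3)[OF H(1)]
      by (simp add: assoc_mult_mat_vec[symmetric, of _ "Suc n" "Suc n" _ "Suc n"])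
    have "bij_betw (\<lambda>A. H * A) {A \<in> ?G. col A n = ?e} {A \<in> ?G. col A n = v}"
      by (rule bij_betw_byWitness[where f' = "\<lambda>A. GL_inv (Suc n) H * A"])
        (use c H GL_inv[OF H(1)] He Hv in \<open>auto simp: GL_mult GL_carrier GL_inv_cancel[OF _ GL_carrier]
            col_mult2[of _ "Suc n" "Suc n" _ "Suc n"] simp del: col_mult2\<close>)
    then show ?thesis by (simp add: bij_betw_same_card)
  qed
  moreover have "card {A \<in> ?G. col A n = ?e} = CARD('a) ^ n * card (GL n :: 'a mat set)"
  proof -
    let ?f = "\<lambda>(A, C). four_block_mat A (0\<^sub>m n 1) C (1\<^sub>m 1) :: 'a mat"
    have "bij_betw ?f (GL n \<times> carrier_mat 1 n) {A \<in> ?G. col A n = ?e}"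
    proof (rule bij_betw_imageI)
      show "inj_on ?f (GL n \<times> carrier_mat 1 n)"
        by (auto simp: inj_on_def GL_carrier four_block_mat_inject[where a = n and b = 1 and c = n and d = 1])
      show "?f ` (GL n \<times> carrier_mat 1 n) = {A \<in> ?G. col A n = ?e}"
      proof (intro equalityI subsetI)
        fix M assume "M \<in> ?f ` (GL n \<times> carrier_mat 1 n)"
        then obtain A C where AC: "A \<in> GL n" "C \<in> carrier_mat 1 n" and M: "M = ?f (A, C)" by auto
        have c: "A \<in> carrier_mat n n" using AC(1) by (rule GL_carrier)
        have "det M = det A"
          using det_four_block_mat_upper_right_zero[OF c refl AC(2), of "1\<^sub>m 1"] by (simp add: M)
        moreover have "M \<in> carrier_mat (Suc n) (Suc n)"
          unfolding M using four_block_carrier_mat[OF c, of "1\<^sub>m 1" 1 1] by simp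
        moreover have "col M n = ?e"
          using c AC(2) by (intro eq_vecI) (auto simp: M)
        ultimately show "M \<in> {A \<in> ?G. col A n = ?e}"
          using AC(1) by (simp add: GL_iff_det)
      next
        fix M assume "M \<in> {A \<in> ?G. col A n = ?e}"
        then have M: "M \<in> ?G" "col M n = ?e" by auto
        have "M \<in> carrier_mat (n + 1) (n + 1)" using GL_carrier[OF M(1)] by simp
        then obtain A B C D where c: "A \<in> carrier_mat n n" "B \<in> carrier_mat n 1" "C \<in> carrier_mat 1 n"
          "D \<in> carrier_mat 1 1" and Meq: "M = four_block_mat A B C D"
          by (rule four_block_mat_exhaust)
        have "M $$ (i, n) = ?e $ i" if "i < Suc n" for i
          using that GL_carrier[OF M(1)] by (simp flip: M(2))
        then have Mi: "four_block_mat A B C D $$ (i, n) = ?e $ i" if "i < Suc n" for i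
          using that Meq by simp
        \<comment> \<open>A unit vector as last column fixes both right-hand blocks; then
          \<open>det M = det A\<close> decides invertibility.\<close>
        have "B = 0\<^sub>m n 1"
        proof (rule eq_matI)
          show "B $$ (i, j) = 0\<^sub>m n 1 $$ (i, j)" if "i < dim_row (0\<^sub>m n 1)" "j < dim_col (0\<^sub>m n 1)" for i j
            using c Mi[of i] that by simp
        qed (use c in auto)
        moreover have "D = 1\<^sub>m 1"
          using c Mi[of n] by (intro eq_matI) auto
        ultimately have Mf: "M = ?f (A, C)" by (simp add: Meq)
        have "det M = det A"
          using det_four_block_mat_upper_right_zero[OF c(1) refl c(3), of "1\<^sub>m 1"] by (simp add: Mf)
        then have "A \<in> GL n" using M(1) c(1) by (simp add: GL_iff_det)
        then show "M \<in> ?f ` (GL n \<times> carrier_mat 1 n)" using c(3) Mf by blast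
      qed
    qed
    from bij_betw_same_card[OF this] show ?thesis
      by (simp add: card_cartesian_product card_carrier_mat mult.commute)
  qed
  moreover have "(\<lambda>A. col A n) ` ?G \<subseteq> ?V"
  proof
    fix v assume "v \<in> (\<lambda>A. col A n) ` ?G"
    then obtain A where A: "A \<in> ?G" "v = col A n" by auto
    then have "v = A *\<^sub>v ?e" using GL_carrier[OF A(1)] by (simp add: mult_unit_vec)
    then show "v \<in> ?V" using nz[OF A(1) e] GL_carrier[OF A(1)] A(2) by auto
  qed
  moreover have "card ?V = CARD('a) ^ Suc n - 1"
    by (simp add: card_carrier_vec)
  ultimately show ?thesis
    using card_equal_fibres[of ?G ?V "\<lambda>A. col A n"] by (simp add: finite_GL card_carrier_vec)
qed

section \<open>Nonsingular alternating matrices\<close>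

text \<open>The last row and the last column cancel each other, and induction removes them. The
  diagonal is a hypothesis of its own because \<open>f i i = - f i i\<close> says nothing in
  characteristic two.\<close>

lemma alternating_sum_zero:
  fixes f :: "nat \<Rightarrow> nat \<Rightarrow> 'a::ab_group_add"
  assumes "\<And>i. i < n \<Longrightarrow> f i i = 0" "\<And>i j. i < n \<Longrightarrow> j < n \<Longrightarrow> f i j = - f j i"
  shows "(\<Sum>i<n. \<Sum>j<n. f i j) = 0"
  using assms
proof (induction n)
  case 0
  show ?case by simp
next
  case (Suc n)
  have "(\<Sum>i<Suc n. \<Sum>j<Suc n. f i j) =
      (\<Sum>i<n. \<Sum>j<n. f i j) + ((\<Sum>i<n. f i n) + (\<Sum>j<n. f n j)) + f n n"
    by (simp only: sum.lessThan_Suc sum.distrib ac_simps)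
  moreover have "(\<Sum>i<n. \<Sum>j<n. f i j) = 0" by (rule Suc.IH; rule Suc.prems; simp)
  moreover have "(\<Sum>i<n. f i n) = - (\<Sum>j<n. f n j)"
    unfolding sum_negf[symmetric] by (intro sum.cong refl Suc.prems(2)) auto
  moreover have "f n n = 0" using Suc.prems(1) by simp
  ultimately show ?case by (metis add_0_left add_0_right left_minus)
qed

text \<open>In characteristic two the second condition is mere symmetry, so the zero diagonal has to
  be demanded separately.\<close>

definition alt_mats :: "nat \<Rightarrow> 'a::ab_group_add mat set" where
  "alt_mats n = {M \<in> carrier_mat n n. (\<forall>i<n. M $$ (i, i) = 0) \<and> (\<forall>i<n. \<forall>j<n. M $$ (i, j) = - M $$ (j, i))}"

lemma index_congruence:
  fixes T :: "'a::comm_ring_1 mat"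
  assumes "T \<in> carrier_mat m n" "M \<in> carrier_mat n n" "i < m" "j < m"
  shows "(T * M * transpose_mat T) $$ (i, j) = (\<Sum>a<n. \<Sum>b<n. T $$ (i, a) * M $$ (a, b) * T $$ (j, b))"
proof -
  have "(T * M * transpose_mat T) $$ (i, j) = (\<Sum>b<n. (\<Sum>a<n. T $$ (i, a) * M $$ (a, b)) * T $$ (j, b))"
    using assms by (simp add: scalar_prod_def lessThan_atLeast0 del: assoc_mult_mat)
  also have "\<dots> = (\<Sum>a<n. \<Sum>b<n. T $$ (i, a) * M $$ (a, b) * T $$ (j, b))"
    unfolding sum_distrib_right by (rule sum.swap)
  finally show ?thesis .
qed

text \<open>The diagonal does not follow from antisymmetry. Entry \<open>(i, i)\<close> is the
  double sum of \<open>T (i, a) * M (a, b) * T (i, b)\<close>, which is again an alternating array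
  in \<open>a\<close> and \<open>b\<close>.\<close>

lemma alt_mats_congruence:
  fixes T :: "'a::comm_ring_1 mat"
  assumes T: "T \<in> carrier_mat m n" and M: "M \<in> alt_mats n"
  shows "T * M * transpose_mat T \<in> alt_mats m"
proof -
  have Mc: "M \<in> carrier_mat n n" and M0: "\<And>i. i < n \<Longrightarrow> M $$ (i, i) = 0"
    and Ma: "\<And>i j. i < n \<Longrightarrow> j < n \<Longrightarrow> M $$ (i, j) = - M $$ (j, i)"
    using M unfolding alt_mats_def by blast+
  have "(T * M * transpose_mat T) $$ (i, i) = 0" if "i < m" for i
    unfolding index_congruence[OF T Mc that that]
  proof (rule alternating_sum_zero)
    show "T $$ (i, a) * M $$ (a, b) * T $$ (i, b) = - (T $$ (i, b) * M $$ (b, a) * T $$ (i, a))"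
      if "a < n" "b < n" for a b
      using Ma[OF that] by (simp add: algebra_simps)
  qed (simp add: M0)
  moreover have "(T * M * transpose_mat T) $$ (i, j) = - (T * M * transpose_mat T) $$ (j, i)"
    if "i < m" "j < m" for i j
  proof -
    have "(\<Sum>a<n. \<Sum>b<n. T $$ (i, a) * M $$ (a, b) * T $$ (j, b)) =
        (\<Sum>b<n. \<Sum>a<n. - (T $$ (j, b) * M $$ (b, a) * T $$ (i, a)))"
    proof (subst sum.swap, intro sum.cong refl)
      fix b a assume "b \<in> {..<n}" "a \<in> {..<n}"
      then show "T $$ (i, a) * M $$ (a, b) * T $$ (j, b) = - (T $$ (j, b) * M $$ (b, a) * T $$ (i, a))"
        using Ma[of a b] by (simp add: algebra_simps)
    qed
    then show ?thesis
      by (simp only: index_congruence[OF T Mc that] index_congruence[OF T Mc that(2,1)] sum_negf)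
  qed
  moreover have "T * M * transpose_mat T \<in> carrier_mat m m"
    using T Mc by simp
  ultimately show ?thesis
    unfolding alt_mats_def by blast
qed

definition alt_GL :: "nat \<Rightarrow> 'a::field mat set" where
  "alt_GL n = alt_mats n \<inter> GL n"

lemma alt_GL_carrier: "M \<in> alt_GL n \<Longrightarrow> M \<in> carrier_mat n n"
  by (simp add: alt_GL_def GL_carrier)

lemma finite_alt_GL: "finite (alt_GL n :: 'a::{field,finite} mat set)"
  by (simp add: alt_GL_def finite_GL)

lemma GL_block_one:
  assumes "A \<in> GL n"
  shows "four_block_mat A (0\<^sub>m n 1) (0\<^sub>m 1 n) (1\<^sub>m 1) \<in> GL (Suc n)"
  using assms det_four_block_mat_upper_right_zero[OF GL_carrier[OF assms] refl, of "0\<^sub>m 1 n" 1 "1\<^sub>m 1"]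
    four_block_carrier_mat[OF GL_carrier[OF assms], of "1\<^sub>m 1" 1 1]
  by (simp add: GL_iff_det)

text \<open>Meant for alternating matrices of size \<open>n + 1\<close>: their corner entry is zero,
  so these \<open>n\<close> entries carry the whole last column.\<close>

definition last_upper_col :: "nat \<Rightarrow> 'a mat \<Rightarrow> 'a vec" where
  "last_upper_col n M = vec n (\<lambda>i. M $$ (i, n))"

text \<open>The last row of \<open>T\<close> is a unit vector, so the right factor leaves the last
  column alone and only \<open>G\<close> acts on it from the left.\<close>

lemma last_upper_col_congruence:
  fixes G :: "'a::comm_ring_1 mat"
  assumes G: "G \<in> carrier_mat n n" and M: "M \<in> carrier_mat (Suc n) (Suc n)" and
    T: "T = four_block_mat G (0\<^sub>m n 1) (0\<^sub>m 1 n) (1\<^sub>m 1)"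
  shows "last_upper_col n (T * M * transpose_mat T) = G *\<^sub>v last_upper_col n M"
proof (rule eq_vecI)
  have Tc: "T \<in> carrier_mat (Suc n) (Suc n)"
    using four_block_carrier_mat[OF G, of "1\<^sub>m 1" 1 1] by (simp add: T)
  fix i assume "i < dim_vec (G *\<^sub>v last_upper_col n M)"
  then have i: "i < n" using G by simp
  have "(\<Sum>b<Suc n. T $$ (i, a) * M $$ (a, b) * T $$ (n, b)) = T $$ (i, a) * M $$ (a, n)" if "a < Suc n" for a
    using G by (simp add: T)
  then have "(T * M * transpose_mat T) $$ (i, n) = (\<Sum>a<Suc n. T $$ (i, a) * M $$ (a, n))"
    using index_congruence[OF Tc M, of i n] i by simp
  also have "\<dots> = (\<Sum>a<n. G $$ (i, a) * M $$ (a, n))"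
    using G i by (simp add: T)
  also have "\<dots> = (G *\<^sub>v last_upper_col n M) $ i"
    using G i by (simp add: last_upper_col_def scalar_prod_def lessThan_atLeast0)
  finally show "last_upper_col n (T * M * transpose_mat T) $ i = (G *\<^sub>v last_upper_col n M) $ i"
    using i by (simp add: last_upper_col_def)
qed (use G in \<open>simp add: last_upper_col_def\<close>)

lemma alt_GL_congruence:
  assumes T: "T \<in> GL n" and M: "M \<in> alt_GL n"
  shows "T * M * transpose_mat T \<in> alt_GL n"
  using assms alt_mats_congruence[OF GL_carrier[OF T], of M] GL_mult[OF GL_mult GL_transpose[OF T], OF T, of M]
  by (simp add: alt_GL_def)

text \<open>The matrix with block rows (N, u, 0), (-u^t, 0, 1), (0, -1, 0). This is the shape forced
  on an alternating matrix whose last column is the unit vector at \<open>k\<close>; the signs keep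
  the count valid over every finite field.\<close>

definition alt_extend :: "nat \<Rightarrow> 'a::field vec \<Rightarrow> 'a mat \<Rightarrow> 'a mat" where
  "alt_extend k u N = mat (k + 2) (k + 2) (\<lambda>(i, j).
     if i < k then (if j < k then N $$ (i, j) else if j = k then u $ i else 0)
     else if i = k then (if j < k then - u $ j else if j = k then 0 else 1)
     else (if j = k then - 1 else 0))"

text \<open>Swapping the last two columns makes the matrix block triangular with diagonal N, 1, -1;
  the sign of the swap cancels the -1.\<close>

lemma det_alt_extend:
  fixes u :: "'a::field vec"
  assumes N: "N \<in> carrier_mat k k"
  shows "det (alt_extend k u N) = det N"
proof -
  let ?M = "alt_extend k u N"
  let ?R = "mat 1 k (\<lambda>(i, j). - u $ j)"
  let ?A = "four_block_mat N (0\<^sub>m k 1) ?R (1\<^sub>m 1)"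
  let ?C = "mat (k + 1) 1 (\<lambda>(i, j). if i < k then u $ i else 0)"
  have M: "?M \<in> carrier_mat (k + 2) (k + 2)" by (simp add: alt_extend_def)
  have A: "?A \<in> carrier_mat (k + 1) (k + 1)" using N by (rule four_block_carrier_mat) simp
  have "swapcols k (k + 1) ?M = four_block_mat ?A ?C (0\<^sub>m 1 (k + 1)) (- 1\<^sub>m 1)"
    using N by (intro eq_matI) (auto simp: alt_extend_def less_Suc_eq)
  moreover have "det (four_block_mat ?A ?C (0\<^sub>m 1 (k + 1)) (- 1\<^sub>m 1)) = det ?A * det (- 1\<^sub>m 1)"
    by (rule det_four_block_mat_lower_left_zero[OF A]) auto
  moreover have "det ?A = det N"
    using det_four_block_mat_upper_right_zero[OF N refl, of ?R 1 "1\<^sub>m 1"] by simp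
  moreover have "det (- 1\<^sub>m 1 :: 'a mat) = - 1"
    by (subst det_single) auto
  moreover have "det (swapcols k (k + 1) ?M) = - det ?M"
    by (rule det_swapcols[OF _ _ _ M]) auto
  ultimately show ?thesis by simp
qed

text \<open>With the last column prescribed, antisymmetry fixes the last row and leaves exactly the
  column \<open>u\<close> and the corner \<open>N\<close> free; nonsingularity passes to
  \<open>N\<close> because the determinants agree.\<close>

lemma bij_betw_alt_extend:
  "bij_betw (\<lambda>(u, N). alt_extend k u N) (carrier_vec k \<times> (alt_GL k :: 'a::field mat set))
    {M \<in> alt_GL (k + 2). last_upper_col (k + 1) M = unit_vec (k + 1) k}"
proof (rule bij_betw_byWitness[where f' = "\<lambda>M. (vec k (\<lambda>i. M $$ (i, k)), mat k k (\<lambda>(i, j). M $$ (i, j)))"])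
  show "\<forall>uN\<in>carrier_vec k \<times> (alt_GL k :: 'a mat set). (\<lambda>M. (vec k (\<lambda>i. M $$ (i, k)), mat k k (\<lambda>(i, j). M $$ (i, j))))
      ((\<lambda>(u, N). alt_extend k u N) uN) = uN"
    by (auto simp: alt_extend_def dest!: alt_GL_carrier intro!: eq_vecI eq_matI)
  have inv: "alt_extend k (vec k (\<lambda>i. M $$ (i, k))) (mat k k (\<lambda>(i, j). M $$ (i, j))) = M"
    if M: "M \<in> alt_mats (k + 2)" and l: "last_upper_col (k + 1) M = unit_vec (k + 1) k" for M :: "'a mat"
  proof -
    have Mc: "M \<in> carrier_mat (k + 2) (k + 2)" and M0: "\<And>i. i < k + 2 \<Longrightarrow> M $$ (i, i) = 0"
      and Ma: "\<And>i j. i < k + 2 \<Longrightarrow> j < k + 2 \<Longrightarrow> M $$ (i, j) = - M $$ (j, i)"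
      using M unfolding alt_mats_def by blast+
    have l: "M $$ (i, k + 1) = (if i = k then 1 else 0)" if "i < k + 1" for i
      using arg_cong[OF l, of "\<lambda>v. v $ i"] that by (simp add: last_upper_col_def)
    show ?thesis
    proof (rule eq_matI)
      fix i j assume "i < dim_row M" "j < dim_col M"
      then have ij: "i < k + 2" "j < k + 2" using Mc by auto
      have "i < k \<or> i = k \<or> i = k + 1" "j < k \<or> j = k \<or> j = k + 1" using ij by auto
      \<comment> \<open>Antisymmetry is needed only below the diagonal in the two extra rows, which
        are cases 4, 7 and 8; the others follow from the prescribed column, the zero diagonal, or
        the definition.\<close>
      then consider "i < k" "j < k" | "i < k" "j = k" | "i < k" "j = k + 1" | "i = k" "j < k"
        | "i = k" "j = k" | "i = k" "j = k + 1" | "i = k + 1" "j < k" | "i = k + 1" "j = k"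
        | "i = k + 1" "j = k + 1" by blast
      then show "alt_extend k (vec k (\<lambda>i. M $$ (i, k))) (mat k k (\<lambda>(i, j). M $$ (i, j))) $$ (i, j) = M $$ (i, j)"
      proof cases
        case 4
        then show ?thesis using Ma[of k j] by (simp add: alt_extend_def)
      next
        case 7
        then show ?thesis using Ma[of "k + 1" j] l[of j] by (simp add: alt_extend_def)
      next
        case 8
        then show ?thesis using Ma[of "k + 1" k] l[of k] by (simp add: alt_extend_def)
      qed (use l[of i] M0[of i] in \<open>simp_all add: alt_extend_def\<close>)
    qed (use Mc in \<open>auto simp: alt_extend_def\<close>)
  qed
  show "\<forall>M\<in>{M \<in> alt_GL (k + 2). last_upper_col (k + 1) M = unit_vec (k + 1) k}. (\<lambda>(u, N). alt_extend k u N)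
      ((\<lambda>M. (vec k (\<lambda>i. M $$ (i, k)), mat k k (\<lambda>(i, j). M $$ (i, j)))) M) = (M :: 'a mat)"
    unfolding alt_GL_def by (rule ballI) (simp only: mem_Collect_eq Int_iff prod.case inv)
  show "(\<lambda>(u, N). alt_extend k u N) ` (carrier_vec k \<times> (alt_GL k :: 'a mat set))
      \<subseteq> {M \<in> alt_GL (k + 2). last_upper_col (k + 1) M = unit_vec (k + 1) k}"
  proof clarify
    fix u :: "'a vec" and N assume uN: "u \<in> carrier_vec k" "N \<in> (alt_GL k :: 'a mat set)"
    have Na: "N $$ (i, j) = - N $$ (j, i)" if "i < k" "j < k" for i j
      using uN that unfolding alt_GL_def alt_mats_def by blast
    have N0: "N $$ (i, i) = 0" if "i < k" for i
      using uN that by (simp add: alt_GL_def alt_mats_def)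
    have "alt_extend k u N $$ (i, j) = - alt_extend k u N $$ (j, i)" if "i < k + 2" "j < k + 2" for i j
    proof (cases "i < k \<and> j < k")
      case True
      then show ?thesis using Na[of i j] by (simp add: alt_extend_def)
    next
      case False
      then show ?thesis using that by (auto simp: alt_extend_def)
    qed
    moreover have "alt_extend k u N $$ (i, i) = 0" if "i < k + 2" for i
      using that N0 by (simp add: alt_extend_def)
    moreover have "alt_extend k u N \<in> carrier_mat (k + 2) (k + 2)"
      by (simp add: alt_extend_def)
    ultimately have "alt_extend k u N \<in> alt_mats (k + 2)"
      unfolding alt_mats_def by blast
    moreover have "last_upper_col (k + 1) (alt_extend k u N) = unit_vec (k + 1) k"
      by (intro eq_vecI) (auto simp: last_upper_col_def alt_extend_def)
    ultimately show "alt_extend k u N \<in> alt_GL (k + 2) \<and> last_upper_col (k + 1) (alt_extend k u N) = unit_vec (k + 1) k"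
      using uN(2) det_alt_extend[OF alt_GL_carrier[OF uN(2)], of u]
      by (simp add: alt_GL_def GL_iff_det) (simp add: alt_extend_def)
  qed
  show "(\<lambda>M. (vec k (\<lambda>i. M $$ (i, k)), mat k k (\<lambda>(i, j). M $$ (i, j)))) `
      {M \<in> alt_GL (k + 2). last_upper_col (k + 1) M = unit_vec (k + 1) k} \<subseteq> carrier_vec k \<times> (alt_GL k :: 'a mat set)"
  proof clarify
    fix M :: "'a mat" assume M: "M \<in> alt_GL (k + 2)" "last_upper_col (k + 1) M = unit_vec (k + 1) k"
    let ?N = "mat k k (\<lambda>(i, j). M $$ (i, j))"
    have "det ?N = det M"
      using det_alt_extend[of ?N k] inv[of M] M by (metis IntD1 alt_GL_def mat_carrier)
    moreover have "?N \<in> alt_mats k"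
      unfolding alt_mats_def
    proof (intro CollectI conjI allI impI)
      show "?N $$ (i, i) = 0" if "i < k" for i
        using M(1) that by (simp add: alt_GL_def alt_mats_def)
      show "?N $$ (i, j) = - ?N $$ (j, i)" if "i < k" "j < k" for i j
      proof -
        have "M $$ (i, j) = - M $$ (j, i)"
          using M(1) that trans_less_add1 unfolding alt_GL_def alt_mats_def by blast
        then show ?thesis using that by simp
      qed
    qed simp
    ultimately show "vec k (\<lambda>i. M $$ (i, k)) \<in> carrier_vec k \<and> ?N \<in> alt_GL k"
      using M(1) by (simp add: alt_GL_def GL_iff_det)
  qed
qed

text \<open>As the corner entry vanishes, zeros above it would make the whole last column
  zero.\<close>

lemma alt_GL_last_upper_col_nonzero:
  assumes M: "M \<in> alt_GL (Suc n)"
  shows "last_upper_col n M \<noteq> 0\<^sub>v n"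
proof
  assume eq: "last_upper_col n M = 0\<^sub>v n"
  have Mc: "M \<in> carrier_mat (Suc n) (Suc n)" using M by (rule alt_GL_carrier)
  have "M $$ (i, n) = 0" if "i < n" for i
    using arg_cong[OF eq, of "\<lambda>v. v $ i"] that by (simp add: last_upper_col_def)
  moreover have "M $$ (n, n) = 0" using M by (simp add: alt_GL_def alt_mats_def)
  ultimately have "col M n = 0\<^sub>v (Suc n)"
    using Mc by (intro eq_vecI) (auto simp: less_Suc_eq)
  then have "M *\<^sub>v unit_vec (Suc n) n = 0\<^sub>v (Suc n)" using Mc by (simp add: mult_unit_vec)
  then have "det M = 0"
    using det_0_iff_vec_prod_zero_field[OF Mc] by (metis lessI unit_vec_carrier unit_vec_nonzero)
  then show False using M by (simp add: alt_GL_def GL_iff_det)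
qed

text \<open>Congruence by the block diagonal matrix of \<open>G\<close> and 1 moves the last column
  by \<open>G\<close>, so GL(k + 1) permutes the fibres over the nonzero vectors transitively. The
  fibre over the unit vector is parametrized by a vector and a smaller nonsingular alternating
  matrix, hence the step of two.\<close>

lemma card_alt_GL_add_2:
  "card (alt_GL (k + 2) :: 'a::{field,finite} mat set) =
    (CARD('a) ^ (k + 1) - 1) * (CARD('a) ^ k * card (alt_GL k :: 'a mat set))"
proof -
  let ?S = "alt_GL (k + 2) :: 'a mat set" and ?g = "last_upper_col (k + 1) :: 'a mat \<Rightarrow> 'a vec"
  let ?V = "carrier_vec (k + 1) - {0\<^sub>v (k + 1)} :: 'a vec set"
  let ?e = "unit_vec (k + 1) k :: 'a vec"
  have Sc: "M \<in> carrier_mat (k + 2) (k + 2)" if "M \<in> ?S" for M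
    using that by (rule alt_GL_carrier)
  have fibre: "card {M \<in> ?S. ?g M = v} = card {M \<in> ?S. ?g M = ?e}" if v: "v \<in> ?V" for v
  proof -
    obtain G where G: "G \<in> GL (k + 1)" "col G k = v"
      using v by (auto elim: exists_GL_last_col[of v k])
    define T where "T A = four_block_mat A (0\<^sub>m (k + 1) 1) (0\<^sub>m 1 (k + 1)) (1\<^sub>m 1)" for A :: "'a mat"
    let ?H = "GL_inv (k + 1) G"
    note Gc = GL_carrier[OF G(1)] and H = GL_inv[OF G(1)]
    have T: "T A \<in> GL (k + 2)" if "A \<in> GL (k + 1)" for A
      using GL_block_one[OF that] by (simp add: T_def)
    have gT: "?g (T A * M * transpose_mat (T A)) = A *\<^sub>v ?g M" if "A \<in> GL (k + 1)" "M \<in> ?S" for A M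
      using last_upper_col_congruence[OF GL_carrier[OF that(1)], of M "T A"] Sc[OF that(2)] by (simp add: T_def)
    have TT: "T A * T B = 1\<^sub>m (k + 2)"
      if "A \<in> carrier_mat (k + 1) (k + 1)" "B \<in> carrier_mat (k + 1) (k + 1)" "A * B = 1\<^sub>m (k + 1)" for A B
      unfolding T_def
      by (subst mult_four_block_mat[where ?nr1.0 = "k + 1" and ?nr2.0 = 1 and ?n1.0 = "k + 1" and ?n2.0 = 1
            and ?nc1.0 = "k + 1" and ?nc2.0 = 1])
        (use that four_block_one_mat[of "k + 1" 1] in auto)
    have Ge: "G *\<^sub>v ?e = v" using Gc G(2) by (simp add: mult_unit_vec)
    have Hv: "?H *\<^sub>v v = ?e"
      unfolding Ge[symmetric] using Gc H
      by (simp add: assoc_mult_mat_vec[symmetric, of _ "k + 1" "k + 1" _ "k + 1"])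
    \<comment> \<open>Congruences by mutually inverse block matrices undo each other; taken in both
      orders this gives the two inverse maps between the fibres.\<close>
    have cancel: "T A * (T B * M * transpose_mat (T B)) * transpose_mat (T A) = M"
      if "A \<in> GL (k + 1)" "B \<in> GL (k + 1)" "A * B = 1\<^sub>m (k + 1)" "M \<in> ?S" for A B M
    proof -
      note c = GL_carrier[OF T[OF that(1)]] GL_carrier[OF T[OF that(2)]] Sc[OF that(4)]
      have AB: "T A * T B = 1\<^sub>m (k + 2)"
        using TT that GL_carrier by blast
      have "T A * (T B * M * transpose_mat (T B)) * transpose_mat (T A) =
          (T A * T B) * M * (transpose_mat (T B) * transpose_mat (T A))"
        using c by (simp add: assoc_mult_mat[of _ "k + 2" "k + 2" _ "k + 2" _ "k + 2"])
      also have "transpose_mat (T B) * transpose_mat (T A) = 1\<^sub>m (k + 2)"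
        using transpose_mult[OF c(1,2)] AB by simp
      finally show ?thesis using c AB by simp
    qed
    have TS: "T A * M * transpose_mat (T A) \<in> ?S" if "A \<in> GL (k + 1)" "M \<in> ?S" for A M
      using alt_GL_congruence[OF T[OF that(1)] that(2)] .
    have "bij_betw (\<lambda>M. T G * M * transpose_mat (T G)) {M \<in> ?S. ?g M = ?e} {M \<in> ?S. ?g M = v}"
      by (rule bij_betw_byWitness[where f' = "\<lambda>M. T ?H * M * transpose_mat (T ?H)"])
        (use G H TS gT Ge Hv cancel in \<open>auto simp del: assoc_mult_mat\<close>)
    then show ?thesis by (simp add: bij_betw_same_card)
  qed
  have fibre_e: "card {M \<in> ?S. ?g M = ?e} = CARD('a) ^ k * card (alt_GL k :: 'a mat set)"
    using bij_betw_same_card[OF bij_betw_alt_extend[of k, where ?'a = 'a]]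
    by (simp add: card_cartesian_product card_carrier_vec)
  have image: "?g ` ?S \<subseteq> ?V"
    using alt_GL_last_upper_col_nonzero[of _ "k + 1"] by (auto simp: last_upper_col_def)
  have card_V: "card ?V = CARD('a) ^ (k + 1) - 1"
    by (simp add: card_carrier_vec)
  show ?thesis
    unfolding card_V[symmetric]
    by (rule card_equal_fibres[OF finite_alt_GL finite_Diff[OF card_carrier_vec(1)] image])
      (simp only: fibre fibre_e)
qed

section \<open>Sums over double cosets\<close>

context group begin

text \<open>The set \<open>?K\<close> acts simply transitively on each fibre of the product map
  \<open>(p, p')\<close> to \<open>p g p'\<close>, so all fibres have the same size.\<close>

lemma double_coset_sum:
  fixes f :: "'a \<Rightarrow> 'c::comm_semiring_1"
  assumes H: "subgroup H G" and fin: "finite H" and g: "g \<in> carrier G"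
    and f: "\<And>x y. x \<in> carrier G \<Longrightarrow> y \<in> carrier G \<Longrightarrow> f (x \<otimes> y) = f (y \<otimes> x)"
  shows "of_nat (card {h \<in> H. g \<otimes> h \<otimes> inv g \<in> H}) * (\<Sum>w\<in>{p \<otimes> g \<otimes> p' | p p'. p \<in> H \<and> p' \<in> H}. f w) =
    of_nat (card H) * (\<Sum>h\<in>H. f (h \<otimes> g))"
proof -
  let ?K = "{h \<in> H. g \<otimes> h \<otimes> inv g \<in> H}" and ?D = "{p \<otimes> g \<otimes> p' | p p'. p \<in> H \<and> p' \<in> H}"
  let ?m = "\<lambda>(p, p'). p \<otimes> g \<otimes> p'"
  have Hc: "h \<in> carrier G" if "h \<in> H" for h using subgroup.mem_carrier[OF H that] .
  note Hm = subgroup.m_closed[OF H] and Hi = subgroup.m_inv_closed[OF H]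
  have D: "?D = ?m ` (H \<times> H)" by auto
  have fibre: "card {x \<in> H \<times> H. ?m x = w} = card ?K" if w: "w \<in> ?D" for w
  proof -
    obtain p0 p1 where p: "p0 \<in> H" "p1 \<in> H" and weq: "w = p0 \<otimes> g \<otimes> p1" using w by blast
    note c = p[THEN Hc] g
    \<comment> \<open>The element \<open>g k g^-1\<close> is absorbed by the left factor and
      \<open>k^-1\<close> by the right one, which leaves the product unchanged.\<close>
    let ?F = "\<lambda>k. (p0 \<otimes> (g \<otimes> k \<otimes> inv g), inv k \<otimes> p1)"
    have "bij_betw ?F ?K {x \<in> H \<times> H. ?m x = w}"
    proof (rule bij_betw_imageI)
      show "inj_on ?F ?K"
        using c by (auto simp: inj_on_def Hc)
      show "?F ` ?K = {x \<in> H \<times> H. ?m x = w}"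
      proof (intro equalityI subsetI)
        fix x assume "x \<in> ?F ` ?K"
        then obtain k where k: "k \<in> H" "g \<otimes> k \<otimes> inv g \<in> H" and x: "x = ?F k" by blast
        have "p0 \<otimes> (g \<otimes> k \<otimes> inv g) \<otimes> g \<otimes> (inv k \<otimes> p1) = w"
          using c Hc[OF k(1)] by (simp add: weq m_assoc) (simp add: m_assoc[symmetric])
        then show "x \<in> {x \<in> H \<times> H. ?m x = w}"
          using k p by (simp add: x Hm Hi)
      next
        fix x assume "x \<in> {x \<in> H \<times> H. ?m x = w}"
        moreover obtain q q' where x: "x = (q, q')" by (cases x)
        ultimately have q: "q \<in> H" "q' \<in> H" "q \<otimes> g \<otimes> q' = w" by auto
        \<comment> \<open>The second component determines \<open>k\<close>; the equation
          \<open>q g q' = p0 g p1\<close> then forces the first component and shows that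
          \<open>g k g^-1\<close> lies in \<open>H\<close>.\<close>
        define k where "k = p1 \<otimes> inv q'"
        have k: "k \<in> H" using p q by (simp add: k_def Hm Hi)
        note c' = c q(1,2)[THEN Hc] Hc[OF k]
        have "q \<otimes> g = p0 \<otimes> g \<otimes> k"
          using c' inv_solve_right[of "q \<otimes> g" "p0 \<otimes> g \<otimes> p1" q'] q(3)
          unfolding weq k_def by (simp add: m_assoc)
        then have "q = p0 \<otimes> g \<otimes> k \<otimes> inv g"
          using c' inv_solve_right[of q "p0 \<otimes> g \<otimes> k" g] by simp
        then have 1: "q = p0 \<otimes> (g \<otimes> k \<otimes> inv g)" using c' by (simp add: m_assoc)
        then have "g \<otimes> k \<otimes> inv g = inv p0 \<otimes> q"
          using c' by (simp add: inv_solve_left)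
        then have 2: "g \<otimes> k \<otimes> inv g \<in> H" using p q by (simp add: Hm Hi)
        have "q' = inv k \<otimes> p1"
          using c' by (simp add: k_def inv_mult_group m_assoc)
        then show "x \<in> ?F ` ?K" using 1 2 k x by blast
      qed
    qed
    then show ?thesis by (simp add: bij_betw_same_card)
  qed
  have "(\<Sum>(p, p')\<in>H \<times> H. f (p \<otimes> g \<otimes> p')) = (\<Sum>x\<in>H \<times> H. f (?m x))"
    by (simp add: case_prod_unfold)
  also have "\<dots> = (\<Sum>w\<in>?D. of_nat (card {x \<in> H \<times> H. ?m x = w}) * f w)"
    by (rule sum_fun_comp) (use fin D in auto)
  also have "\<dots> = of_nat (card ?K) * (\<Sum>w\<in>?D. f w)"
    unfolding sum_distrib_left by (intro sum.cong refl) (simp only: fibre)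
  finally have "of_nat (card ?K) * (\<Sum>w\<in>?D. f w) = (\<Sum>(p, p')\<in>H \<times> H. f (p \<otimes> g \<otimes> p'))" by simp
  also have "\<dots> = (\<Sum>p'\<in>H. \<Sum>p\<in>H. f (p \<otimes> g \<otimes> p'))"
    unfolding sum.cartesian_product[symmetric] by (rule sum.swap)
  also have "\<dots> = (\<Sum>p'\<in>H. \<Sum>h\<in>H. f (h \<otimes> g))"
  proof (rule sum.cong[OF refl])
    fix p' assume p': "p' \<in> H"
    \<comment> \<open>Cyclic invariance of \<open>f\<close> brings \<open>p'\<close> to the front,
      where it merely permutes \<open>H\<close>.\<close>
    have "(\<Sum>p\<in>H. f (p \<otimes> g \<otimes> p')) = (\<Sum>p\<in>H. f (p' \<otimes> p \<otimes> g))"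
    proof (rule sum.cong[OF refl])
      fix p assume "p \<in> H"
      then show "f (p \<otimes> g \<otimes> p') = f (p' \<otimes> p \<otimes> g)"
        using p' g Hc f[of "p \<otimes> g" p'] m_assoc[of p' p g] by simp
    qed
    also have "\<dots> = (\<Sum>h\<in>H. f (h \<otimes> g))"
      by (rule sum.reindex_bij_witness[where i = "\<lambda>h. inv p' \<otimes> h" and j = "\<lambda>p. p' \<otimes> p"])
        (use p' Hc Hm Hi in \<open>auto simp: m_assoc[symmetric]\<close>)
    finally show "(\<Sum>p\<in>H. f (p \<otimes> g \<otimes> p')) = (\<Sum>h\<in>H. f (h \<otimes> g))" .
  qed
  finally show ?thesis by simp
qed

end

section \<open>The parabolic subgroup\<close>

definition sympl_form :: "nat \<Rightarrow> 'a::{zero,one} mat" where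
  "sympl_form n = four_block_mat (0\<^sub>m n n) (1\<^sub>m n) (1\<^sub>m n) (0\<^sub>m n n)"

lemma GL_inv_transpose:
  assumes "A \<in> GL n"
  shows "transpose_mat A * transpose_mat (GL_inv n A) = 1\<^sub>m n" "transpose_mat (GL_inv n A) * transpose_mat A = 1\<^sub>m n"
  using transpose_mult[OF GL_inv(1) GL_carrier, OF assms assms] GL_inv(3)[OF assms] transpose_one
    transpose_mult[OF GL_carrier GL_inv(1), OF assms assms] GL_inv(2)[OF assms]
  by metis+

text \<open>For block upper triangular \<open>w\<close> the isometry condition splits: the first two
  equations make \<open>D\<close> the inverse transpose of \<open>A\<close>, and the third will
  become the symmetry of \<open>B\<close>.\<close>

lemma sympl_form_preserved_iff:
  fixes A :: "'a::comm_ring_1 mat"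
  assumes A: "A \<in> carrier_mat n n" and X: "X \<in> carrier_mat n n" and D: "D \<in> carrier_mat n n"
    and w: "w = four_block_mat A X (0\<^sub>m n n) D"
  shows "transpose_mat w * sympl_form n * w = sympl_form n \<longleftrightarrow>
    transpose_mat A * D = 1\<^sub>m n \<and> transpose_mat D * A = 1\<^sub>m n \<and>
    transpose_mat X * D + transpose_mat D * X = 0\<^sub>m n n"
proof -
  let ?A = "transpose_mat A" and ?X = "transpose_mat X" and ?D = "transpose_mat D"
  have c: "?A \<in> carrier_mat n n" "?X \<in> carrier_mat n n" "?D \<in> carrier_mat n n"
    using assms by auto
  have "transpose_mat w = four_block_mat ?A (0\<^sub>m n n) ?X ?D"
    unfolding w using transpose_four_block_mat[OF A X zero_carrier_mat D] by simp
  moreover have "\<dots> * sympl_form n = four_block_mat (0\<^sub>m n n) ?A ?D ?X"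
    unfolding sympl_form_def using c
    by (subst mult_four_block_mat[where ?nr1.0 = n and ?nr2.0 = n and ?n1.0 = n and ?n2.0 = n and ?nc1.0 = n and ?nc2.0 = n]) auto
  moreover have "\<dots> * w = four_block_mat (0\<^sub>m n n) (?A * D) (?D * A) (?D * X + ?X * D)"
    unfolding w using c A X D
    by (subst mult_four_block_mat[where ?nr1.0 = n and ?nr2.0 = n and ?n1.0 = n and ?n2.0 = n and ?nc1.0 = n and ?nc2.0 = n]) auto
  ultimately have "transpose_mat w * sympl_form n * w = sympl_form n \<longleftrightarrow>
    four_block_mat (0\<^sub>m n n) (?A * D) (?D * A) (?D * X + ?X * D) = four_block_mat (0\<^sub>m n n) (1\<^sub>m n) (1\<^sub>m n) (0\<^sub>m n n)"
    by (simp add: sympl_form_def)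
  also have "\<dots> \<longleftrightarrow> 0\<^sub>m n n = (0\<^sub>m n n :: 'a mat) \<and> ?A * D = 1\<^sub>m n \<and> ?D * A = 1\<^sub>m n \<and> ?D * X + ?X * D = 0\<^sub>m n n"
    by (rule four_block_mat_inject) (use c A X D in auto)
  finally show ?thesis using c A X D by (auto simp: comm_add_mat[of "?D * X" n n "?X * D"])
qed

definition parabolic_elt :: "nat \<Rightarrow> 'a::field mat \<Rightarrow> 'a mat \<Rightarrow> 'a mat" where
  "parabolic_elt n A B = four_block_mat A (A * B) (0\<^sub>m n n) (transpose_mat (GL_inv n A))"

lemma parabolic_eq: "(parabolic n :: 'a::field mat set) = (\<lambda>(A, B). parabolic_elt n A B) ` (GL n \<times> symm_mats n)"
proof -
  have "four_block_mat A (0\<^sub>m n n) (0\<^sub>m n n) (transpose_mat (GL_inv n A)) *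
      four_block_mat (1\<^sub>m n) B (0\<^sub>m n n) (1\<^sub>m n) = parabolic_elt n A B"
    if "A \<in> GL n" "B \<in> carrier_mat n n" for A B :: "'a mat"
    using that GL_carrier[OF that(1)] GL_inv(1)[OF that(1)] unfolding parabolic_elt_def
    by (subst mult_four_block_mat[where ?nr1.0 = n and ?nr2.0 = n and ?n1.0 = n and ?n2.0 = n and ?nc1.0 = n and ?nc2.0 = n]) auto
  then have "(parabolic n :: 'a mat set) = {parabolic_elt n A B | A B. A \<in> GL n \<and> B \<in> carrier_mat n n \<and> transpose_mat B = B}"
    unfolding parabolic_def by (intro Collect_cong ex_cong1) auto
  then show ?thesis
    by (auto simp: symm_mats_def)
qed

lemma inj_on_parabolic_elt: "inj_on (\<lambda>(A, B). parabolic_elt n A B) (GL n \<times> symm_mats n :: ('a::field mat \<times> 'a mat) set)"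
proof (rule inj_onI, clarify)
  fix A B A' B' :: "'a mat"
  assume *: "A \<in> GL n" "B \<in> symm_mats n" "A' \<in> GL n" "B' \<in> symm_mats n"
    and eq: "parabolic_elt n A B = parabolic_elt n A' B'"
  have B: "B \<in> carrier_mat n n" "B' \<in> carrier_mat n n" using * by (auto simp: symm_mats_def)
  note c = GL_carrier[OF *(1)] GL_carrier[OF *(3)] GL_inv(1)[OF *(1)] GL_inv(1)[OF *(3)]
  have "A = A' \<and> A * B = A' * B' \<and> 0\<^sub>m n n = (0\<^sub>m n n :: 'a mat) \<and> transpose_mat (GL_inv n A) = transpose_mat (GL_inv n A')"
    using c B eq unfolding parabolic_elt_def
    by (subst (asm) four_block_mat_inject[where a = n and b = n and c = n and d = n]) auto
  then show "A = A' \<and> B = B'"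
    using GL_inv_cancel(1)[OF *(1)] B by metis
qed

text \<open>Characteristic two is needed because \<open>sympl_form\<close> carries no sign: its isometries are the
  symplectic ones only there.\<close>
lemma parabolic_iff:
  fixes w :: "'a::field mat"
  assumes two: "(1::'a) + 1 = 0"
  shows "w \<in> parabolic n \<longleftrightarrow> w \<in> carrier_mat (n + n) (n + n) \<and>
    transpose_mat w * sympl_form n * w = sympl_form n \<and> (\<forall>i<n. \<forall>j<n. w $$ (n + i, j) = 0)"
proof
  have two': "M + M = 0\<^sub>m n n" if "M \<in> carrier_mat n n" for M :: "'a mat"
  proof -
    have "x + x = 0" for x :: 'a using arg_cong[OF two, of "\<lambda>c. c * x"] by (simp add: algebra_simps)
    then show ?thesis using that by (intro eq_matI) auto
  qed
  {
    assume "w \<in> parabolic n"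
    then obtain A B where A: "A \<in> GL n" and "B \<in> symm_mats n" and w: "w = parabolic_elt n A B"
      by (auto simp: parabolic_eq)
    then have B: "B \<in> carrier_mat n n" "transpose_mat B = B" by (auto simp: symm_mats_def)
    let ?D = "transpose_mat (GL_inv n A)"
    note c = GL_carrier[OF A] GL_inv[OF A]
    have D: "?D \<in> carrier_mat n n" using c by simp
    have AB: "A * B \<in> carrier_mat n n" using c B by simp
    \<comment> \<open>Both terms of the third isometry equation equal \<open>B\<close>, so their sum
      is \<open>B + B\<close>, which is zero in characteristic two.\<close>
    have 1: "transpose_mat (A * B) * ?D = B"
      using c B D GL_inv_transpose(1)[OF A] by (simp add: transpose_mult)
    have 2: "transpose_mat ?D * (A * B) = B"
      using GL_inv_cancel(1)[OF A B(1)] by simp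
    have "transpose_mat w * sympl_form n * w = sympl_form n"
      unfolding w parabolic_elt_def
      by (subst sympl_form_preserved_iff[OF c(1) AB D refl])
        (use GL_inv_transpose(1)[OF A] c B GL_inv_cancel(1)[OF A B(1)] in \<open>simp add: 1 2 two'\<close>)
    moreover have "w \<in> carrier_mat (n + n) (n + n)"
      unfolding w parabolic_elt_def using c(1) D by (rule four_block_carrier_mat)
    moreover have "\<forall>i<n. \<forall>j<n. w $$ (n + i, j) = 0"
      using c D by (simp add: w parabolic_elt_def)
    ultimately show "w \<in> carrier_mat (n + n) (n + n) \<and>
      transpose_mat w * sympl_form n * w = sympl_form n \<and> (\<forall>i<n. \<forall>j<n. w $$ (n + i, j) = 0)" by blast
  next
    assume w: "w \<in> carrier_mat (n + n) (n + n) \<and>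
      transpose_mat w * sympl_form n * w = sympl_form n \<and> (\<forall>i<n. \<forall>j<n. w $$ (n + i, j) = 0)"
    then have "w \<in> carrier_mat (n + n) (n + n)" by blast
    then obtain A X C D where c: "A \<in> carrier_mat n n" "X \<in> carrier_mat n n" "C \<in> carrier_mat n n"
      "D \<in> carrier_mat n n" and weq: "w = four_block_mat A X C D"
      by (rule four_block_mat_exhaust)
    have "C $$ (i, j) = w $$ (n + i, j)" if "i < n" "j < n" for i j
      using c that by (simp add: weq)
    then have "C = 0\<^sub>m n n" using w c by (intro eq_matI) auto
    then have weq: "w = four_block_mat A X (0\<^sub>m n n) D" using weq by simp
    have *: "transpose_mat A * D = 1\<^sub>m n" "transpose_mat D * A = 1\<^sub>m n"
      "transpose_mat X * D + transpose_mat D * X = 0\<^sub>m n n"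
      using sympl_form_preserved_iff[OF c(1,2,4) weq] w by blast+
    have DA: "A * transpose_mat D = 1\<^sub>m n" using mat_mult_left_right_inverse[OF _ c(1) *(2)] c by simp
    have A: "A \<in> GL n" "GL_inv n A = transpose_mat D"
      using GL_inv_eqI[OF c(1) _ DA] c by auto
    \<comment> \<open>Since \<open>transpose_mat D\<close> is the inverse of \<open>A\<close>, this
      choice gives \<open>A * B = X\<close>. The third equation reads
      \<open>transpose_mat B + B = 0\<close>, which is symmetry in characteristic two.\<close>
    define B where "B = transpose_mat D * X"
    have B: "B \<in> carrier_mat n n" using c by (simp add: B_def)
    have Bt: "transpose_mat B = transpose_mat X * D"
      using c by (simp add: B_def transpose_mult[of _ n n])
    have "transpose_mat B + B = 0\<^sub>m n n" using *(3) unfolding Bt unfolding B_def .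
    then have "transpose_mat B + B + B = 0\<^sub>m n n + B" by simp
    then have "transpose_mat B = B"
      using B two'[OF B] by (simp add: assoc_add_mat[of "transpose_mat B" n n B B])
    moreover have "A * B = X"
      using GL_inv_cancel(2)[OF A(1) c(2)] by (simp add: B_def A(2))
    ultimately have "B \<in> symm_mats n" "w = parabolic_elt n A B"
      using B weq A(2) by (auto simp: symm_mats_def parabolic_elt_def)
    then show "w \<in> parabolic n" using A(1) by (auto simp: parabolic_eq)
  }
qed

text \<open>Left translation by an element of \<open>H\<close> is a permutation of \<open>H\<close>,
  which yields the unit and inverses. It spares the computation of inverses in the parabolic
  subgroup.\<close>

lemma (in group) finite_closed_subgroup:
  assumes "H \<subseteq> carrier G" "finite H" "H \<noteq> {}" "\<And>a b. a \<in> H \<Longrightarrow> b \<in> H \<Longrightarrow> a \<otimes> b \<in> H"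
  shows "subgroup H G"
proof (rule subgroupI)
  fix a assume a: "a \<in> H"
  have "inj_on (\<lambda>x. a \<otimes> x) H" by (intro inj_onI) (metis a assms(1) Units_eq Units_l_cancel subsetD)
  then have surj: "(\<lambda>x. a \<otimes> x) ` H = H"
    by (intro endo_inj_surj assms) (use a assms(4) in auto)
  obtain x where x: "x \<in> H" "a = a \<otimes> x" using surj a by auto
  then have "\<one> \<in> H" using a assms(1) by (metis l_cancel_one' subsetD)
  then obtain y where y: "y \<in> H" "\<one> = a \<otimes> y" using surj by auto
  then have "inv a = y" using a assms(1) by (metis inv_equality inv_inv subsetD)
  then show "inv a \<in> H" using y by simp
qed (use assms in auto)

lemma parabolic_subset_GL: "parabolic n \<subseteq> GL (n + n)"
proof
  fix w :: "'a::field mat" assume "w \<in> parabolic n"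
  then obtain A B where A: "A \<in> GL n" and B: "B \<in> symm_mats n" and w: "w = parabolic_elt n A B"
    by (auto simp: parabolic_eq)
  note c = GL_carrier[OF A]
  have D: "transpose_mat (GL_inv n A) \<in> GL n" by (rule GL_transpose[OF GL_inv(4)[OF A]])
  have AB: "A * B \<in> carrier_mat n n" using c B by (simp add: symm_mats_def)
  have "det w = det A * det (transpose_mat (GL_inv n A))"
    unfolding w parabolic_elt_def by (rule det_four_block_mat_lower_left_zero[OF c AB refl GL_carrier[OF D]])
  then have "det w \<noteq> 0" using A D by (simp add: GL_iff_det)
  moreover have "w \<in> carrier_mat (n + n) (n + n)"
    unfolding w parabolic_elt_def using c GL_carrier[OF D] by (rule four_block_carrier_mat)
  ultimately show "w \<in> GL (n + n)" by (simp add: GL_iff_det)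
qed

abbreviation GL_group :: "'a::field itself \<Rightarrow> nat \<Rightarrow> 'a mat monoid" where
  "GL_group T n \<equiv> units_of (ring_mat T n ())"

lemma group_GL_group: "group (GL_group TYPE('a::field) n)"
proof -
  interpret ring "ring_mat TYPE('a) n ()" by (rule ring_mat)
  show ?thesis by (rule units_group)
qed

lemma GL_group_simps:
  "carrier (GL_group TYPE('a::field) n) = GL n"
  "mult (GL_group TYPE('a) n) = (*)"
  "one (GL_group TYPE('a) n) = 1\<^sub>m n"
  by (simp_all add: units_of_carrier units_of_mult units_of_one GL_def ring_mat_simps)

text \<open>Preserving the form and having a zero lower left block are both stable under products,
  so the parameters \<open>A\<close> and \<open>B\<close> need not be tracked.\<close>

lemma parabolic_mult:
  fixes w w' :: "'a::field mat"
  assumes two: "(1::'a) + 1 = 0" and w: "w \<in> parabolic n" and w': "w' \<in> parabolic n"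
  shows "w * w' \<in> parabolic n"
proof -
  let ?J = "sympl_form n :: 'a mat"
  have w: "w \<in> carrier_mat (n + n) (n + n)" "transpose_mat w * ?J * w = ?J" "\<forall>i<n. \<forall>j<n. w $$ (n + i, j) = 0"
    and w': "w' \<in> carrier_mat (n + n) (n + n)" "transpose_mat w' * ?J * w' = ?J" "\<forall>i<n. \<forall>j<n. w' $$ (n + i, j) = 0"
    using w w' parabolic_iff[OF two] by blast+
  have "(w * w') $$ (n + i, j) = 0" if ij: "i < n" "j < n" for i j
  proof -
    have "w $$ (n + i, k) * w' $$ (k, j) = 0" if "k < n + n" for k
    proof (cases "k < n")
      case False
      then show ?thesis using w'(3) ij that
        by (metis add_less_cancel_left le_add_diff_inverse linorder_not_less mult_zero_right)
    qed (use w ij in simp)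
    then have "(\<Sum>k = 0..<n + n. w $$ (n + i, k) * w' $$ (k, j)) = 0" by (intro sum.neutral) simp
    then show ?thesis using w(1) w'(1) ij by (simp add: scalar_prod_def)
  qed
  moreover have "transpose_mat (w * w') * ?J * (w * w') = ?J"
  proof -
    have J: "?J \<in> carrier_mat (n + n) (n + n)" by (simp add: sympl_form_def)
    have "transpose_mat (w * w') * ?J * (w * w') = transpose_mat w' * (transpose_mat w * ?J * w) * w'"
      using w(1) w'(1) J by (simp add: transpose_mult[OF w(1) w'(1)]
          assoc_mult_mat[of _ "n + n" "n + n" _ "n + n" _ "n + n"])
    then show ?thesis using w(2) w'(2) by simp
  qed
  ultimately show ?thesis using w(1) w'(1) by (simp add: parabolic_iff[OF two])
qed

lemma finite_parabolic: "finite (parabolic n :: 'a::{field,finite} mat set)"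
  by (simp add: parabolic_eq finite_GL finite_symm_mats)

lemma card_parabolic:
  "card (parabolic n :: 'a::{field,finite} mat set) =
    card (GL n :: 'a mat set) * card (symm_mats n :: 'a mat set)"
  by (simp add: parabolic_eq card_image inj_on_parabolic_elt card_cartesian_product)

lemma one_symm_mats: "1\<^sub>m n \<in> symm_mats n"
  by (simp add: symm_mats_def)

lemma subgroup_parabolic:
  assumes two: "(1::'a::{field,finite}) + 1 = 0"
  shows "subgroup (parabolic n) (GL_group TYPE('a) (n + n))"
proof -
  interpret group "GL_group TYPE('a) (n + n)" by (rule group_GL_group)
  show ?thesis
  proof (rule finite_closed_subgroup)
    show "(parabolic n :: 'a mat set) \<noteq> {}"
      using one_GL[of n] one_symm_mats[of n] by (auto simp: parabolic_eq)
  qed (use parabolic_mult[OF two] parabolic_subset_GL[of n] finite_parabolic in \<open>auto simp: GL_group_simps\<close>)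
qed

section \<open>The Weyl elements and their stabilizers\<close>

text \<open>Diagonal idempotents. They turn \<open>sigma\<close> into a two by two array of
  \<open>n\<close> x \<open>n\<close> matrices E and F, so products reduce to
  \<open>E * E = E\<close>, \<open>E * F = 0\<close> and \<open>E + F = 1\<close> and no
  sixteen-block computation arises.\<close>

definition coord_proj :: "nat \<Rightarrow> (nat \<Rightarrow> bool) \<Rightarrow> 'a::{zero,one} mat" where
  "coord_proj n P = mat n n (\<lambda>(i, j). if i = j \<and> P i then 1 else 0)"

lemma coord_proj_carrier [simp]: "coord_proj n P \<in> carrier_mat n n"
  by (simp add: coord_proj_def)

lemma coord_proj_transpose [simp]: "transpose_mat (coord_proj n P) = coord_proj n P"
  by (intro eq_matI) (auto simp: coord_proj_def)

lemma index_coord_proj_mult: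
  fixes M :: "'a::semiring_1 mat"
  assumes "M \<in> carrier_mat n m" "i < n" "j < m"
  shows "(coord_proj n P * M) $$ (i, j) = (if P i then M $$ (i, j) else 0)"
proof -
  have "row (coord_proj n P :: 'a mat) i = (if P i then unit_vec n i else 0\<^sub>v n)"
    using assms by (intro eq_vecI) (auto simp: coord_proj_def)
  moreover have "(coord_proj n P * M) $$ (i, j) = row (coord_proj n P) i \<bullet> col M j"
    using assms by (simp add: coord_proj_def)
  ultimately show ?thesis using assms by (cases "P i") auto
qed

lemma index_mult_coord_proj:
  fixes M :: "'a::semiring_1 mat"
  assumes "M \<in> carrier_mat m n" "i < m" "j < n"
  shows "(M * coord_proj n P) $$ (i, j) = (if P j then M $$ (i, j) else 0)"
proof -
  have "col (coord_proj n P :: 'a mat) j = (if P j then unit_vec n j else 0\<^sub>v n)"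
    using assms by (intro eq_vecI) (auto simp: coord_proj_def)
  moreover have "(M * coord_proj n P) $$ (i, j) = row M i \<bullet> col (coord_proj n P) j"
    using assms by (simp add: coord_proj_def)
  ultimately show ?thesis using assms scalar_prod_right_unit[of j n "row M i"] by (cases "P j") auto
qed

lemma coord_proj_mult:
  "coord_proj n P * coord_proj n Q = (coord_proj n (\<lambda>i. P i \<and> Q i) :: 'a::semiring_1 mat)"
proof (rule eq_matI)
  fix i j assume "i < dim_row (coord_proj n (\<lambda>i. P i \<and> Q i) :: 'a mat)" "j < dim_col (coord_proj n (\<lambda>i. P i \<and> Q i) :: 'a mat)"
  then show "(coord_proj n P * coord_proj n Q) $$ (i, j) = (coord_proj n (\<lambda>i. P i \<and> Q i) :: 'a mat) $$ (i, j)"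
    by (subst index_coord_proj_mult[where m = n]) (auto simp: coord_proj_def)
qed (auto simp: coord_proj_def)

lemma coord_proj_complement:
  fixes s n :: nat
  defines "E \<equiv> coord_proj n (\<lambda>i. i < s) :: 'a::semiring_1 mat" and "F \<equiv> coord_proj n (\<lambda>i. s \<le> i) :: 'a mat"
  shows "E * E = E" "F * F = F" "E * F = 0\<^sub>m n n" "F * E = 0\<^sub>m n n" "E + F = 1\<^sub>m n" "F + E = 1\<^sub>m n"
  unfolding E_def F_def coord_proj_mult by (auto intro!: eq_matI simp: coord_proj_def)

lemma sigma_eq:
  assumes "s \<le> n"
  shows "sigma n s = four_block_mat (coord_proj n (\<lambda>i. s \<le> i)) (coord_proj n (\<lambda>i. i < s))
    (coord_proj n (\<lambda>i. i < s)) (coord_proj n (\<lambda>i. s \<le> i))"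
proof -
  have "four_block_mat (1\<^sub>m s) (0\<^sub>m s (n - s)) (0\<^sub>m (n - s) s) (0\<^sub>m (n - s) (n - s)) = (coord_proj n (\<lambda>i. i < s) :: 'a mat)"
    using assms by (intro eq_matI) (auto simp: coord_proj_def)
  moreover have "four_block_mat (0\<^sub>m s s) (0\<^sub>m s (n - s)) (0\<^sub>m (n - s) s) (1\<^sub>m (n - s)) = (coord_proj n (\<lambda>i. s \<le> i) :: 'a mat)"
    using assms by (intro eq_matI) (auto simp: coord_proj_def)
  ultimately show ?thesis by (simp add: sigma_def Let_def)
qed

lemma sigma_carrier: "s \<le> n \<Longrightarrow> sigma n s \<in> carrier_mat (n + n) (n + n)"
  by (simp add: sigma_eq)

lemma sigma_transpose: "s \<le> n \<Longrightarrow> transpose_mat (sigma n s) = sigma n s"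
  using transpose_four_block_mat[OF coord_proj_carrier coord_proj_carrier coord_proj_carrier coord_proj_carrier]
  by (simp add: sigma_eq)

lemma sigma_sq:
  assumes "s \<le> n"
  shows "sigma n s * sigma n s = (1\<^sub>m (n + n) :: 'a::field mat)"
proof -
  have "sigma n s * sigma n s = four_block_mat (1\<^sub>m n) (0\<^sub>m n n) (0\<^sub>m n n) (1\<^sub>m n :: 'a mat)"
    unfolding sigma_eq[OF assms]
    by (subst mult_four_block_mat[OF coord_proj_carrier coord_proj_carrier coord_proj_carrier coord_proj_carrier
        coord_proj_carrier coord_proj_carrier coord_proj_carrier coord_proj_carrier])
      (simp add: coord_proj_complement)
  then show ?thesis by simp
qed

lemma sigma_preserves_form:
  assumes "s \<le> n"
  shows "sigma n s * sympl_form n * sigma n s = (sympl_form n :: 'a::field mat)"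
proof -
  let ?E = "coord_proj n (\<lambda>i. i < s) :: 'a mat" and ?F = "coord_proj n (\<lambda>i. s \<le> i) :: 'a mat"
  have "sigma n s * sympl_form n = four_block_mat ?E ?F ?F ?E"
    unfolding sigma_eq[OF assms] sympl_form_def
    by (subst mult_four_block_mat[OF coord_proj_carrier coord_proj_carrier coord_proj_carrier coord_proj_carrier
        zero_carrier_mat one_carrier_mat one_carrier_mat zero_carrier_mat])
      (simp add: right_mult_zero_mat[OF coord_proj_carrier] right_mult_one_mat[OF coord_proj_carrier]
        left_add_zero_mat[OF coord_proj_carrier] right_add_zero_mat[OF coord_proj_carrier])
  also have "\<dots> * sigma n s = sympl_form n"
    unfolding sigma_eq[OF assms] sympl_form_def
    by (subst mult_four_block_mat[OF coord_proj_carrier coord_proj_carrier coord_proj_carrier coord_proj_carrier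
        coord_proj_carrier coord_proj_carrier coord_proj_carrier coord_proj_carrier])
      (simp add: coord_proj_complement)
  finally show ?thesis .
qed

text \<open>The lower left block of the conjugate is \<open>E A F + E X E + F D E\<close>, and the
  three summands occupy disjoint positions. No other block is needed to test membership in the
  parabolic subgroup.\<close>

lemma index_sigma_conj:
  fixes A X D :: "'a::field mat"
  assumes s: "s \<le> n" and c: "A \<in> carrier_mat n n" "X \<in> carrier_mat n n" "D \<in> carrier_mat n n"
    and ij: "i < n" "j < n"
  shows "(sigma n s * four_block_mat A X (0\<^sub>m n n) D * sigma n s) $$ (n + i, j) =
    (if i < s then (if j < s then X $$ (i, j) else A $$ (i, j)) else if j < s then D $$ (i, j) else 0)"
proof -
  let ?E = "coord_proj n (\<lambda>i. i < s) :: 'a mat" and ?F = "coord_proj n (\<lambda>i. s \<le> i) :: 'a mat"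
  have 1: "sigma n s * four_block_mat A X (0\<^sub>m n n) D =
      four_block_mat (?F * A) (?F * X + ?E * D) (?E * A) (?E * X + ?F * D)"
    unfolding sigma_eq[OF s] using c
    by (subst mult_four_block_mat[OF coord_proj_carrier coord_proj_carrier coord_proj_carrier coord_proj_carrier
        c(1,2) zero_carrier_mat c(3)])
      (use c in \<open>simp add: right_mult_zero_mat[OF coord_proj_carrier]
        right_add_zero_mat[OF mult_carrier_mat[OF coord_proj_carrier]]\<close>)
  have c': "?F * A \<in> carrier_mat n n" "?F * X + ?E * D \<in> carrier_mat n n"
    "?E * A \<in> carrier_mat n n" "?E * X + ?F * D \<in> carrier_mat n n"
    using c by (simp_all add: mult_carrier_mat[OF coord_proj_carrier])
  have "(sigma n s * four_block_mat A X (0\<^sub>m n n) D * sigma n s) $$ (n + i, j) =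
      (?E * A * ?F + (?E * X + ?F * D) * ?E) $$ (i, j)"
    unfolding 1 unfolding sigma_eq[OF s]
    by (subst mult_four_block_mat[OF c' coord_proj_carrier coord_proj_carrier coord_proj_carrier coord_proj_carrier])
      (use c' ij in \<open>simp add: coord_proj_def\<close>)
  also have "\<dots> = (?E * A * ?F) $$ (i, j) + ((?E * X + ?F * D) * ?E) $$ (i, j)"
    using ij by (simp add: coord_proj_def)
  also have "\<dots> = (if i < s then (if j < s then X $$ (i, j) else A $$ (i, j)) else if j < s then D $$ (i, j) else 0)"
  proof -
    have "(?E * X + ?F * D) $$ (i, j) = (?E * X) $$ (i, j) + (?F * D) $$ (i, j)"
      using c ij by (intro index_add_mat) (simp_all add: coord_proj_def)
    then show ?thesis
      using c c' ij by (simp add: index_mult_coord_proj[where m = n] index_coord_proj_mult[where m = n] del: index_mult_mat(1))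
  qed
  finally show ?thesis .
qed

text \<open>Isolates \<open>B\<close> in the single term \<open>Tr (E A B)\<close>, obtained from
  \<open>Tr (A B E)\<close> by cyclicity. The rest depends on \<open>A\<close> alone and can be
  pulled out of the sum over \<open>B\<close>.\<close>

lemma trace_parabolic_sigma:
  fixes A B :: "'a::field mat"
  assumes s: "s \<le> n" and A: "A \<in> GL n" and B: "B \<in> carrier_mat n n"
  shows "mat_trace (parabolic_elt n A B * sigma n s) =
    (\<Sum>i=s..<n. A $$ (i, i) + GL_inv n A $$ (i, i)) + mat_trace (coord_proj n (\<lambda>i. i < s) * A * B)"
proof -
  let ?E = "coord_proj n (\<lambda>i. i < s) :: 'a mat" and ?F = "coord_proj n (\<lambda>i. s \<le> i) :: 'a mat"
  let ?D = "transpose_mat (GL_inv n A)"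
  have c: "A \<in> carrier_mat n n" "A * B \<in> carrier_mat n n" "?D \<in> carrier_mat n n"
    using GL_carrier[OF A] B GL_inv(1)[OF A] by simp_all
  have c': "A * ?F + A * B * ?E \<in> carrier_mat n n" "?D * ?F \<in> carrier_mat n n"
    using c by (simp_all add: mult_carrier_mat[OF _ coord_proj_carrier])
  have "parabolic_elt n A B * sigma n s = four_block_mat (A * ?F + A * B * ?E) (A * ?E + A * B * ?F) (?D * ?E) (?D * ?F)"
    unfolding parabolic_elt_def sigma_eq[OF s]
    by (subst mult_four_block_mat[OF c(1,2) zero_carrier_mat c(3)
          coord_proj_carrier coord_proj_carrier coord_proj_carrier coord_proj_carrier])
      (use c in \<open>simp add: left_mult_zero_mat[OF coord_proj_carrier] left_add_zero_mat[OF mult_carrier_mat[OF _ coord_proj_carrier]]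
          del: assoc_mult_mat\<close>)
  then have "mat_trace (parabolic_elt n A B * sigma n s) = mat_trace (A * ?F + A * B * ?E) + mat_trace (?D * ?F)"
    using c' by (simp add: trace_four_block_mat)
  also have "mat_trace (A * ?F + A * B * ?E) = mat_trace (A * ?F) + mat_trace (A * B * ?E)"
    by (intro mat_trace_add[of _ n] mult_carrier_mat[OF _ coord_proj_carrier] c)
  also have "mat_trace (A * B * ?E) = mat_trace (?E * (A * B))"
    by (rule mat_trace_comm[OF c(2) coord_proj_carrier])
  also have "?E * (A * B) = ?E * A * B"
    using c(1) B by (simp add: assoc_mult_mat[OF coord_proj_carrier c(1) B])
  finally have "mat_trace (parabolic_elt n A B * sigma n s) = mat_trace (A * ?F) + mat_trace (?D * ?F) + mat_trace (?E * A * B)"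
    by (simp add: ac_simps)
  moreover have tr: "mat_trace (M * ?F) = (\<Sum>i=s..<n. M $$ (i, i))" if "M \<in> carrier_mat n n" for M
  proof -
    have "mat_trace (M * ?F) = (\<Sum>i<n. if s \<le> i then M $$ (i, i) else 0)"
      using that by (simp add: mat_trace_def index_mult_coord_proj[where m = n] del: index_mult_mat(1))
    also have "\<dots> = (\<Sum>i\<in>{i \<in> {..<n}. s \<le> i}. M $$ (i, i))"
      by (rule sum.inter_filter[symmetric]) simp
    also have "{i \<in> {..<n}. s \<le> i} = {s..<n}" by auto
    finally show ?thesis .
  qed
  moreover have "mat_trace (?D * ?F) = (\<Sum>i=s..<n. GL_inv n A $$ (i, i))"
    using GL_inv(1)[OF A] by (subst tr[OF c(3)]) (intro sum.cong refl, simp)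
  ultimately show ?thesis using tr[OF c(1)] by (simp add: sum.distrib)
qed

section \<open>Character sums\<close>

lemma additive_character_zero: "additive_character \<psi> \<Longrightarrow> \<psi> 0 = 1"
  unfolding additive_character_def by (metis add_0 mult_cancel_right1)

lemma symm_mats_add: "A \<in> symm_mats n \<Longrightarrow> B \<in> symm_mats n \<Longrightarrow> A + B \<in> symm_mats n"
  by (auto simp: symm_mats_def transpose_add[of _ n n])

lemma symm_mats_uminus: "A \<in> symm_mats n \<Longrightarrow> - A \<in> (symm_mats n :: 'a::ab_group_add mat set)"
proof -
  assume A: "A \<in> symm_mats n"
  then have c: "A \<in> carrier_mat n n" "transpose_mat A = A" by (auto simp: symm_mats_def)
  have "A $$ (j, i) = A $$ (i, j)" if "i < n" "j < n" for i j
    using c(1) that by (subst c(2)[symmetric]) (simp del: c(2))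
  then show ?thesis using c by (auto simp: symm_mats_def intro!: eq_matI)
qed

text \<open>For symmetric \<open>B\<close> the trace is the sum of
  \<open>M (i, i) * B (i, i)\<close> over \<open>i\<close> and of
  \<open>(M (i, j) + M (j, i)) * B (i, j)\<close> over \<open>i < j\<close>. If \<open>M\<close> is
  not alternating, some coefficient is nonzero, and the witness is a scaled diagonal matrix unit or
  a scaled sum of two mirrored ones.\<close>

lemma symm_trace_surj:
  fixes M :: "'a::field mat"
  assumes M: "M \<in> carrier_mat n n" "M \<notin> alt_mats n"
  obtains B where "B \<in> symm_mats n" "mat_trace (M * B) = c"
proof -
  consider k where "k < n" "M $$ (k, k) \<noteq> 0" | k l where "k < n" "l < n" "k \<noteq> l" "M $$ (k, l) + M $$ (l, k) \<noteq> 0"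
  proof -
    obtain k l where kl: "k < n" "l < n" "M $$ (k, k) \<noteq> 0 \<or> M $$ (k, l) + M $$ (l, k) \<noteq> 0"
      using M unfolding alt_mats_def eq_neg_iff_add_eq_0 by blast
    show thesis
    proof (cases "M $$ (k, k) = 0")
      case True
      then have "k \<noteq> l" using kl(3) by auto
      then show thesis using that(2) kl True by blast
    qed (use that(1) kl(1) in blast)
  qed
  then show thesis
  proof cases
    case 1
    let ?B = "mat n n (\<lambda>(i, j). if i = k \<and> j = k then c / M $$ (k, k) else 0)"
    have "mat_trace (M * ?B) = (\<Sum>i<n. \<Sum>j<n. if i = k then if j = k then c else 0 else 0)"
      unfolding mat_trace_mult[OF M(1) mat_carrier] using 1 by (intro sum.cong refl) auto
    also have "\<dots> = (\<Sum>i<n. if i = k then c else 0)"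
      using 1 by (intro sum.cong refl) simp
    also have "\<dots> = c" using 1 by simp
    finally show thesis by (intro that[of ?B]) (auto simp: symm_mats_def intro!: eq_matI)
  next
    case 2
    let ?d = "c / (M $$ (k, l) + M $$ (l, k))"
    let ?B = "mat n n (\<lambda>(i, j). if i = k \<and> j = l \<or> i = l \<and> j = k then ?d else 0)"
    have "mat_trace (M * ?B) = (\<Sum>i<n. \<Sum>j<n. (if i = k then if j = l then M $$ (k, l) * ?d else 0 else 0)
        + (if i = l then if j = k then M $$ (l, k) * ?d else 0 else 0))"
      unfolding mat_trace_mult[OF M(1) mat_carrier] using 2 by (intro sum.cong refl) auto
    also have "\<dots> = (\<Sum>i<n. (if i = k then M $$ (k, l) * ?d else 0) + (if i = l then M $$ (l, k) * ?d else 0))"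
      using 2 by (intro sum.cong refl) (simp add: sum.distrib)
    also have "\<dots> = M $$ (k, l) * ?d + M $$ (l, k) * ?d" using 2 by (simp add: sum.distrib)
    also have "\<dots> = c" using 2(4) by (simp only: distrib_right[symmetric]) simp
    finally show thesis by (intro that[of ?B]) (auto simp: symm_mats_def intro!: eq_matI)
  qed
qed

lemma alt_symm_trace_zero:
  fixes M :: "'a::comm_ring_1 mat"
  assumes M: "M \<in> alt_mats n" and B: "B \<in> symm_mats n"
  shows "mat_trace (M * B) = 0"
proof -
  have c: "M \<in> carrier_mat n n" "B \<in> carrier_mat n n" "transpose_mat B = B"
    using M B by (auto simp: alt_mats_def symm_mats_def)
  have B: "B $$ (j, i) = B $$ (i, j)" if "i < n" "j < n" for i j
    using c(2) that by (subst c(3)[symmetric]) (simp del: c(3))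
  show ?thesis unfolding mat_trace_mult[OF c(1,2)]
  proof (rule alternating_sum_zero)
    show "M $$ (i, i) * B $$ (i, i) = 0" if "i < n" for i
      using M that by (simp add: alt_mats_def)
    show "M $$ (i, j) * B $$ (j, i) = - (M $$ (j, i) * B $$ (i, j))" if "i < n" "j < n" for i j
    proof -
      have "M $$ (i, j) = - M $$ (j, i)" using M that unfolding alt_mats_def by blast
      then show ?thesis using B[OF that] by simp
    qed
  qed
qed

text \<open>Orthogonality: if \<open>M\<close> is not alternating, translation by a suitable
  \<open>B0\<close> multiplies the sum by some \<open>\<psi> c \<noteq> 1\<close>, so the sum is
  zero. For alternating \<open>M\<close> every term is 1.\<close>

lemma character_sum_symm:
  fixes M :: "'a::{field,finite} mat"
  assumes \<psi>: "additive_character \<psi>" "nontrivial_character \<psi>" and M: "M \<in> carrier_mat n n"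
  shows "(\<Sum>B\<in>symm_mats n. \<psi> (mat_trace (M * B))) =
    (if M \<in> alt_mats n then of_nat (card (symm_mats n :: 'a mat set)) else 0)"
proof (cases "M \<in> alt_mats n")
  case True
  then show ?thesis by (simp add: alt_symm_trace_zero additive_character_zero[OF \<psi>(1)])
next
  case False
  obtain c where c: "\<psi> c \<noteq> 1" using \<psi>(2) by (auto simp: nontrivial_character_def)
  obtain B0 where B0: "B0 \<in> symm_mats n" "mat_trace (M * B0) = c"
    using symm_trace_surj[OF M False] .
  have sc: "B \<in> carrier_mat n n" if "B \<in> symm_mats n" for B :: "'a mat" using that by (simp add: symm_mats_def)
  let ?S = "\<Sum>B\<in>symm_mats n. \<psi> (mat_trace (M * B))"
  have "?S = (\<Sum>B\<in>symm_mats n. \<psi> (mat_trace (M * (B0 + B))))"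
  proof (rule sum.reindex_bij_witness[where i = "\<lambda>B. B0 + B" and j = "\<lambda>B. - B0 + B"])
    fix B :: "'a mat" assume B: "B \<in> symm_mats n"
    show "B0 + (- B0 + B) = B" "- B0 + (B0 + B) = B"
      using sc[OF B] sc[OF B0(1)] by (auto intro!: eq_matI)
    show "\<psi> (mat_trace (M * (B0 + (- B0 + B)))) = \<psi> (mat_trace (M * B))"
      using \<open>B0 + (- B0 + B) = B\<close> by simp
  qed (use B0(1) in \<open>auto intro: symm_mats_add symm_mats_uminus\<close>)
  also have "\<dots> = \<psi> c * ?S"
    unfolding sum_distrib_left
  proof (rule sum.cong[OF refl])
    fix B :: "'a mat" assume B: "B \<in> symm_mats n"
    have "M * (B0 + B) = M * B0 + M * B" using M sc[OF B] sc[OF B0(1)] by (simp add: mult_add_distrib_mat)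
    then have "mat_trace (M * (B0 + B)) = c + mat_trace (M * B)"
      using M sc[OF B] sc[OF B0(1)] B0(2) by (simp add: mat_trace_add[of _ n])
    then show "\<psi> (mat_trace (M * (B0 + B))) = \<psi> c * \<psi> (mat_trace (M * B))"
      using \<psi>(1) by (simp add: additive_character_def)
  qed
  finally show ?thesis using c False by simp
qed

section \<open>Block lower triangular matrices\<close>

definition lower_block :: "nat \<Rightarrow> nat \<Rightarrow> 'a::zero mat \<times> 'a mat \<times> 'a mat \<Rightarrow> 'a mat" where
  "lower_block s t = (\<lambda>(A, C, D). four_block_mat A (0\<^sub>m s t) C D)"

lemma lower_block_GL_iff:
  fixes A :: "'a::field mat"
  assumes "A \<in> carrier_mat s s" "C \<in> carrier_mat t s" "D \<in> carrier_mat t t"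
  shows "lower_block s t (A, C, D) \<in> GL (s + t) \<longleftrightarrow> A \<in> GL s \<and> D \<in> GL t"
  using assms det_four_block_mat_upper_right_zero[OF assms(1) refl assms(2,3)]
  by (auto simp: lower_block_def GL_iff_det)

lemma inj_on_lower_block:
  "inj_on (lower_block s t) (carrier_mat s s \<times> carrier_mat t s \<times> carrier_mat t t)"
proof (rule inj_onI)
  fix x y :: "'a mat \<times> 'a mat \<times> 'a mat"
  assume "x \<in> carrier_mat s s \<times> carrier_mat t s \<times> carrier_mat t t" "y \<in> carrier_mat s s \<times> carrier_mat t s \<times> carrier_mat t t"
    and eq: "lower_block s t x = lower_block s t y"
  moreover obtain A C D A' C' D' where xy: "x = (A, C, D)" "y = (A', C', D')" by (metis prod_cases3)
  ultimately have c: "A \<in> carrier_mat s s" "C \<in> carrier_mat t s" "D \<in> carrier_mat t t"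
    "A' \<in> carrier_mat s s" "C' \<in> carrier_mat t s" "D' \<in> carrier_mat t t" by auto
  show "x = y"
    using four_block_mat_inject[OF c(1) zero_carrier_mat c(2,3) c(4) zero_carrier_mat c(5,6)] eq
    unfolding xy lower_block_def prod.case by blast
qed

text \<open>Needed twice: the lower right block of the inverse supplies the second trace in the
  Kloosterman sum, and its zero upper right block settles one of the stabilizer conditions.\<close>

lemma GL_inv_lower_block:
  fixes A :: "'a::field mat"
  assumes A: "A \<in> GL s" and C: "C \<in> carrier_mat t s" and D: "D \<in> GL t"
  shows "GL_inv (s + t) (lower_block s t (A, C, D)) =
    lower_block s t (GL_inv s A, - (GL_inv t D * C * GL_inv s A), GL_inv t D)"
proof (rule GL_inv_eqI(2))
  note c = GL_carrier[OF A] C GL_carrier[OF D] GL_inv(1)[OF A] GL_inv(1)[OF D]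
  let ?C = "- (GL_inv t D * C * GL_inv s A)"
  have C': "?C \<in> carrier_mat t s" using c by simp
  show "lower_block s t (A, C, D) \<in> carrier_mat (s + t) (s + t)"
    "lower_block s t (GL_inv s A, ?C, GL_inv t D) \<in> carrier_mat (s + t) (s + t)"
    using c unfolding lower_block_def by simp_all
  have "D * ?C = - (D * (GL_inv t D * (C * GL_inv s A)))"
    using c by (simp add: assoc_mult_mat[of "GL_inv t D" t t C s "GL_inv s A" s])
  also have "\<dots> = - (C * GL_inv s A)"
    using GL_inv_cancel(2)[OF D, of "C * GL_inv s A" s] c by simp
  finally have DC: "D * ?C = - (C * GL_inv s A)" .
  have CC: "C * GL_inv s A + - (C * GL_inv s A) = 0\<^sub>m t s"
    using c by (intro eq_matI) auto
  have "lower_block s t (A, C, D) * lower_block s t (GL_inv s A, ?C, GL_inv t D) =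
      four_block_mat (A * GL_inv s A + 0\<^sub>m s t * ?C) (A * 0\<^sub>m s t + 0\<^sub>m s t * GL_inv t D)
        (C * GL_inv s A + D * ?C) (C * 0\<^sub>m s t + D * GL_inv t D)"
    unfolding lower_block_def prod.case
    by (rule mult_four_block_mat[OF c(1) zero_carrier_mat c(2,3) c(4) zero_carrier_mat C' c(5)])
  also have "\<dots> = four_block_mat (1\<^sub>m s) (0\<^sub>m s t) (0\<^sub>m t s) (1\<^sub>m t)"
    unfolding DC CC left_mult_zero_mat[OF C'] using c GL_inv(2)[OF A] GL_inv(2)[OF D] by simp
  finally show "lower_block s t (A, C, D) * lower_block s t (GL_inv s A, ?C, GL_inv t D) = 1\<^sub>m (s + t)"
    by simp
qed

lemma lower_block_exhaust:
  assumes M: "M \<in> carrier_mat (s + t) (s + t)" and zero: "\<And>i j. i < s \<Longrightarrow> s \<le> j \<Longrightarrow> j < s + t \<Longrightarrow> M $$ (i, j) = 0"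
  obtains A C D where "A \<in> carrier_mat s s" "C \<in> carrier_mat t s" "D \<in> carrier_mat t t"
    "M = lower_block s t (A, C, D)"
proof -
  obtain A B C D where c: "A \<in> carrier_mat s s" "B \<in> carrier_mat s t" "C \<in> carrier_mat t s"
    "D \<in> carrier_mat t t" and Meq: "M = four_block_mat A B C D"
    using M by (rule four_block_mat_exhaust)
  have "B $$ (i, j) = 0" if "i < s" "j < t" for i j
    using zero[of i "s + j"] c that by (simp add: Meq)
  then have "B = 0\<^sub>m s t" using c by (intro eq_matI) auto
  then show thesis using that[OF c(1,3,4)] Meq by (simp add: lower_block_def)
qed

lemma index_lower_block:
  assumes "A \<in> carrier_mat s s" "D \<in> carrier_mat t t" "i < s + t" "j < s + t"
  shows "lower_block s t (A, C, D) $$ (i, j) =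
    (if i < s then if j < s then A $$ (i, j) else 0 else if j < s then C $$ (i - s, j) else D $$ (i - s, j - s))"
  using assms by (auto simp: lower_block_def)

text \<open>Multiplying by the projection erases the rows from \<open>s\<close> on. An alternating
  matrix with these rows zero has the corresponding columns zero too, so only an alternating
  \<open>s\<close> x \<open>s\<close> corner is left; invertibility then passes to the two diagonal
  blocks.\<close>

lemma alt_coord_proj_mult_iff:
  fixes A :: "'a::field mat"
  shows "{A \<in> GL (s + t). coord_proj (s + t) (\<lambda>i. i < s) * A \<in> alt_mats (s + t)} =
    lower_block s t ` (alt_GL s \<times> carrier_mat t s \<times> (GL t :: 'a mat set))" (is "?L = ?R")
proof (intro equalityI subsetI)
  let ?E = "coord_proj (s + t) (\<lambda>i. i < s) :: 'a mat"
  fix M assume M: "M \<in> ?L"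
  then have Mc: "M \<in> carrier_mat (s + t) (s + t)" by (simp add: GL_carrier)
  have E: "(?E * M) $$ (i, j) = (if i < s then M $$ (i, j) else 0)" if "i < s + t" "j < s + t" for i j
    using index_coord_proj_mult[OF Mc that] .
  have anti: "(?E * M) $$ (i, j) = - (?E * M) $$ (j, i)" if "i < s + t" "j < s + t" for i j
    using M that unfolding alt_mats_def by blast
  have diag: "(?E * M) $$ (i, i) = 0" if "i < s + t" for i
    using M that unfolding alt_mats_def by blast
  \<comment> \<open>The mirrored entry lies in an erased row.\<close>
  have "M $$ (i, j) = 0" if "i < s" "s \<le> j" "j < s + t" for i j
    using anti[of i j] E[of i j] E[of j i] that by simp
  then obtain A C D where c: "A \<in> carrier_mat s s" "C \<in> carrier_mat t s" "D \<in> carrier_mat t t"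
    and Meq: "M = lower_block s t (A, C, D)"
    using lower_block_exhaust[OF Mc] by blast
  have AE: "A $$ (i, j) = (?E * M) $$ (i, j)" if "i < s" "j < s" for i j
    using E[of i j] index_lower_block[OF c(1,3), of i j C] that Meq by simp
  then have "A $$ (i, i) = 0" if "i < s" for i
    using diag[of i] that by (metis trans_less_add1)
  moreover have "A $$ (i, j) = - A $$ (j, i)" if "i < s" "j < s" for i j
    using AE[OF that] AE[OF that(2,1)] anti[of i j] that by (metis trans_less_add1)
  ultimately have "A \<in> alt_mats s"
    using c(1) unfolding alt_mats_def by blast
  then show "M \<in> ?R"
    using M lower_block_GL_iff[OF c] c by (auto simp: Meq alt_GL_def)
next
  let ?E = "coord_proj (s + t) (\<lambda>i. i < s) :: 'a mat"
  fix M assume "M \<in> ?R"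
  then obtain A C D where A: "A \<in> alt_GL s" and C: "C \<in> carrier_mat t s" and D: "D \<in> GL t"
    and M: "M = lower_block s t (A, C, D)" by auto
  have c: "A \<in> carrier_mat s s" "D \<in> carrier_mat t t"
    using alt_GL_carrier[OF A] GL_carrier[OF D] by auto
  have MGL: "M \<in> GL (s + t)"
    unfolding M using lower_block_GL_iff[OF c(1) C c(2)] A D by (simp add: alt_GL_def)
  have E: "(?E * M) $$ (i, j) = (if i < s \<and> j < s then A $$ (i, j) else 0)" if "i < s + t" "j < s + t" for i j
    using index_coord_proj_mult[OF GL_carrier[OF MGL] that] index_lower_block[OF c that, of C] M by simp
  have anti: "A $$ (i, j) = - A $$ (j, i)" if "i < s" "j < s" for i j
    using A that unfolding alt_GL_def alt_mats_def by blast
  have "A $$ (i, i) = 0" if "i < s" for i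
    using A that unfolding alt_GL_def alt_mats_def by blast
  then have "(?E * M) $$ (i, i) = 0" if "i < s + t" for i using E[of i i] that by simp
  moreover have "(?E * M) $$ (i, j) = - (?E * M) $$ (j, i)" if "i < s + t" "j < s + t" for i j
    using E[OF that] E[OF that(2,1)] anti[of i j] by (auto split: if_splits)
  moreover have "?E * M \<in> carrier_mat (s + t) (s + t)"
    using GL_carrier[OF MGL] by (simp add: mult_carrier_mat[OF coord_proj_carrier])
  ultimately have "?E * M \<in> alt_mats (s + t)" unfolding alt_mats_def by blast
  then show "M \<in> ?L" using MGL by simp
qed

text \<open>On the surviving block matrices the remaining trace depends only on the lower right
  block \<open>D\<close>. The alternating corner and the free block \<open>C\<close> contribute just
  their number, the latter \<open>CARD('a) ^ (s * t)\<close>.\<close>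

lemma sum_parabolic_sigma:
  fixes \<psi> :: "'a::{field,finite} \<Rightarrow> complex"
  assumes \<psi>: "additive_character \<psi>" "nontrivial_character \<psi>"
  shows "(\<Sum>w\<in>parabolic (s + t). \<psi> (mat_trace (w * sigma (s + t) s))) =
    of_nat (card (symm_mats (s + t) :: 'a mat set) * card (alt_GL s :: 'a mat set) * CARD('a) ^ (s * t)) *
    kloosterman_GL t \<psi> 1"
proof -
  let ?n = "s + t"
  let ?E = "coord_proj ?n (\<lambda>i. i < s) :: 'a mat"
  define g where "g A = \<psi> (\<Sum>i=s..<?n. A $$ (i, i) + GL_inv ?n A $$ (i, i))" for A :: "'a mat"
  have add: "\<psi> (x + y) = \<psi> x * \<psi> y" for x y using \<psi>(1) by (simp add: additive_character_def)
  have "(\<Sum>w\<in>parabolic ?n. \<psi> (mat_trace (w * sigma ?n s))) =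
      (\<Sum>(A, B)\<in>GL ?n \<times> symm_mats ?n. \<psi> (mat_trace (parabolic_elt ?n A B * sigma ?n s)))"
    unfolding parabolic_eq sum.reindex[OF inj_on_parabolic_elt] by (simp add: case_prod_unfold)
  also have "\<dots> = (\<Sum>A\<in>GL ?n. \<Sum>B\<in>symm_mats ?n. \<psi> (mat_trace (parabolic_elt ?n A B * sigma ?n s)))"
    by (simp add: sum.cartesian_product)
  also have "\<dots> = (\<Sum>A\<in>GL ?n. g A * (\<Sum>B\<in>symm_mats ?n. \<psi> (mat_trace (?E * A * B))))"
    unfolding sum_distrib_left
    by (intro sum.cong refl) (simp add: trace_parabolic_sigma symm_mats_def add g_def)
  also have "\<dots> = (\<Sum>A\<in>GL ?n. if ?E * A \<in> alt_mats ?n then g A * of_nat (card (symm_mats ?n :: 'a mat set)) else 0)"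
    by (intro sum.cong refl) (simp add: character_sum_symm[OF \<psi>] mult_carrier_mat[OF coord_proj_carrier] GL_carrier)
  also have "\<dots> = (\<Sum>A\<in>{A \<in> GL ?n. ?E * A \<in> alt_mats ?n}. g A * of_nat (card (symm_mats ?n :: 'a mat set)))"
    by (rule sum.inter_filter[symmetric]) (rule finite_GL)
  also have "\<dots> = of_nat (card (symm_mats ?n :: 'a mat set)) * (\<Sum>A\<in>{A \<in> GL ?n. ?E * A \<in> alt_mats ?n}. g A)"
    unfolding sum_distrib_left by (simp add: mult.commute)
  also have "(\<Sum>A\<in>{A \<in> GL ?n. ?E * A \<in> alt_mats ?n}. g A) =
      (\<Sum>x\<in>alt_GL s \<times> carrier_mat t s \<times> (GL t :: 'a mat set). g (lower_block s t x))"
    unfolding alt_coord_proj_mult_iff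
    by (subst sum.reindex) (auto intro: inj_on_subset[OF inj_on_lower_block] simp: GL_carrier alt_GL_carrier)
  also have "\<dots> = (\<Sum>x\<in>(alt_GL s :: 'a mat set) \<times> (carrier_mat t s :: 'a mat set) \<times> GL t. \<psi> (mat_trace (snd (snd x)) + mat_trace (GL_inv t (snd (snd x)))))"
  proof (rule sum.cong[OF refl])
    fix x :: "'a mat \<times> 'a mat \<times> 'a mat" assume "x \<in> alt_GL s \<times> carrier_mat t s \<times> GL t"
    then obtain A C D where x: "x = (A, C, D)" and A: "A \<in> GL s" and C: "C \<in> carrier_mat t s" and D: "D \<in> GL t"
      by (auto simp: alt_GL_def)
    have tr: "(\<Sum>i=s..<?n. lower_block s t (A', C', D') $$ (i, i)) = mat_trace D'"
      if "A' \<in> carrier_mat s s" "D' \<in> carrier_mat t t" for A' C' D' :: "'a mat"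
    proof -
      have "(\<Sum>i=s..<?n. lower_block s t (A', C', D') $$ (i, i)) = (\<Sum>i=s..<?n. D' $$ (i - s, i - s))"
        using that by (intro sum.cong refl) (simp add: index_lower_block)
      also have "\<dots> = (\<Sum>i<t. D' $$ (i, i))"
        by (rule sum.reindex_bij_witness[where i = "\<lambda>i. i + s" and j = "\<lambda>i. i - s"]) auto
      finally show ?thesis using that by (simp add: mat_trace_def)
    qed
    show "g (lower_block s t x) = \<psi> (mat_trace (snd (snd x)) + mat_trace (GL_inv t (snd (snd x))))"
      unfolding g_def x GL_inv_lower_block[OF A C D]
      by (simp add: sum.distrib tr GL_carrier A D GL_inv)
  qed
  also have "\<dots> = of_nat (card (alt_GL s :: 'a mat set) * CARD('a) ^ (s * t)) * kloosterman_GL t \<psi> 1"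
    by (simp add: sum.cartesian_product' card_carrier_mat kloosterman_GL_def mult.commute)
  finally show ?thesis by simp
qed

text \<open>Three entry conditions on the lower left block must hold: the upper right part of
  \<open>A\<close> vanishes, the \<open>s\<close> x \<open>s\<close> corner of \<open>A * B\<close>
  vanishes, and so does the lower left part of the inverse transpose of \<open>A\<close>. Given the
  first, the second says that the corner of \<open>B\<close> is zero and the third is
  automatic.\<close>

lemma sigma_conj_stabilizer:
  fixes s t :: nat
  assumes two: "(1::'a::{field,finite}) + 1 = 0"
  shows "{w \<in> parabolic (s + t). sigma (s + t) s * w * sigma (s + t) s \<in> parabolic (s + t)} =
    (\<lambda>(A, B). parabolic_elt (s + t) A B) `
      (lower_block s t ` (GL s \<times> carrier_mat t s \<times> GL t) \<times>
       (\<lambda>(B, D). four_block_mat (0\<^sub>m s s) B (transpose_mat B) D) ` (carrier_mat s t \<times> (symm_mats t :: 'a mat set)))"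
    (is "?K = ?f ` (?L \<times> ?S)")
proof -
  let ?n = "s + t" and ?\<sigma> = "sigma (s + t) s :: 'a mat"
  let ?J = "sympl_form ?n :: 'a mat"
  have \<sigma>: "?\<sigma> \<in> carrier_mat (?n + ?n) (?n + ?n)" by (rule sigma_carrier) simp
  have J: "?J \<in> carrier_mat (?n + ?n) (?n + ?n)" by (simp add: sympl_form_def)
  have mem: "?f (A, B) \<in> ?K \<longleftrightarrow> A \<in> ?L \<and> B \<in> ?S" if A: "A \<in> GL ?n" and B: "B \<in> symm_mats ?n" for A B
  proof -
    let ?w = "parabolic_elt ?n A B" and ?D = "transpose_mat (GL_inv ?n A)"
    have Bc: "B \<in> carrier_mat ?n ?n" using B by (simp add: symm_mats_def)
    note c = GL_carrier[OF A] mult_carrier_mat[OF GL_carrier[OF A] Bc]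
    have D: "?D \<in> carrier_mat ?n ?n" using GL_inv(1)[OF A] by simp
    have w: "?w \<in> parabolic ?n" using A B by (auto simp: parabolic_eq)
    then have wc: "?w \<in> carrier_mat (?n + ?n) (?n + ?n)" "transpose_mat ?w * ?J * ?w = ?J"
      using parabolic_iff[OF two] by blast+
    \<comment> \<open>As \<open>sigma\<close> is symmetric, reassociation produces the inner product
      \<open>sigma * J * sigma\<close>, which is \<open>J\<close> again.\<close>
    have "transpose_mat (?\<sigma> * ?w * ?\<sigma>) * ?J * (?\<sigma> * ?w * ?\<sigma>) = ?\<sigma> * (transpose_mat ?w * (?\<sigma> * ?J * ?\<sigma>) * ?w) * ?\<sigma>"
      using \<sigma> J wc(1) sigma_transpose[of s ?n, where ?'a = 'a]
      by (simp add: transpose_mult[of _ "?n + ?n" "?n + ?n" _ "?n + ?n"]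
          assoc_mult_mat[of _ "?n + ?n" "?n + ?n" _ "?n + ?n" _ "?n + ?n"] mult_carrier_mat[of _ "?n + ?n" "?n + ?n" _ "?n + ?n"])
    also have "\<dots> = ?J" using wc(2) sigma_preserves_form[of s ?n, where ?'a = 'a] by simp
    finally have form: "transpose_mat (?\<sigma> * ?w * ?\<sigma>) * ?J * (?\<sigma> * ?w * ?\<sigma>) = ?J" .
    have "?w \<in> ?K \<longleftrightarrow> (\<forall>i<?n. \<forall>j<?n. (?\<sigma> * ?w * ?\<sigma>) $$ (?n + i, j) = 0)"
    proof -
      have "?\<sigma> * ?w * ?\<sigma> \<in> carrier_mat (?n + ?n) (?n + ?n)"
        by (intro mult_carrier_mat[of _ _ "?n + ?n"] \<sigma> wc(1))
      then show ?thesis using w form parabolic_iff[OF two, of "?\<sigma> * ?w * ?\<sigma>" ?n] by blast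
    qed
    also have "\<dots> \<longleftrightarrow> (\<forall>i<?n. \<forall>j<?n. (if i < s then (if j < s then (A * B) $$ (i, j) else A $$ (i, j))
        else if j < s then ?D $$ (i, j) else 0) = 0)"
      unfolding parabolic_elt_def by (simp only: index_sigma_conj[OF _ c D] le_add1 cong: imp_cong)
    also have "\<dots> \<longleftrightarrow> A \<in> ?L \<and> B \<in> ?S"
    proof -
      obtain B1 B2 B3 B4 where Bb: "B1 \<in> carrier_mat s s" "B2 \<in> carrier_mat s t" "B3 \<in> carrier_mat t s"
        "B4 \<in> carrier_mat t t" and Beq: "B = four_block_mat B1 B2 B3 B4"
        using Bc by (rule four_block_mat_exhaust)
      have Bs: "B1 \<in> symm_mats s" "B3 = transpose_mat B2" "B4 \<in> symm_mats t"
        using B symm_mats_block[OF Bb] by (auto simp: Beq)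
      \<comment> \<open>For block lower triangular \<open>A\<close> the corner of the product
        involves only the corners of the factors; since \<open>A1\<close> is invertible, it vanishes
        only with \<open>B1\<close>.\<close>
      have AB: "(A * B) $$ (i, j) = (A1 * B1) $$ (i, j)"
        if "A1 \<in> carrier_mat s s" "C1 \<in> carrier_mat t s" "D1 \<in> carrier_mat t t" "A = lower_block s t (A1, C1, D1)"
          "i < s" "j < s" for A1 C1 D1 i j
      proof -
        have "A * B = four_block_mat (A1 * B1 + 0\<^sub>m s t * B3) (A1 * B2 + 0\<^sub>m s t * B4) (C1 * B1 + D1 * B3) (C1 * B2 + D1 * B4)"
          unfolding that(4) Beq lower_block_def prod.case
          by (rule mult_four_block_mat[OF that(1) zero_carrier_mat that(2,3) Bb])
        then show ?thesis using that Bb by simp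
      qed
      show ?thesis
      proof
        assume *: "\<forall>i<?n. \<forall>j<?n. (if i < s then (if j < s then (A * B) $$ (i, j) else A $$ (i, j))
          else if j < s then ?D $$ (i, j) else 0) = 0"
        have "A $$ (i, j) = 0" if "i < s" "s \<le> j" "j < ?n" for i j
          using *[rule_format, of i j] that by simp
        then obtain A1 C1 D1 where Ab: "A1 \<in> carrier_mat s s" "C1 \<in> carrier_mat t s" "D1 \<in> carrier_mat t t"
          and Aeq: "A = lower_block s t (A1, C1, D1)"
          using lower_block_exhaust[OF c(1)] by blast
        have A1: "A1 \<in> GL s" "D1 \<in> GL t" using A lower_block_GL_iff[OF Ab] by (auto simp: Aeq)
        have "(A1 * B1) $$ (i, j) = 0" if "i < s" "j < s" for i j
          using *[rule_format, of i j] AB[OF Ab Aeq that] that by simp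
        then have "A1 * B1 = 0\<^sub>m s s"
          using Ab Bb by (intro eq_matI) (auto simp del: index_mult_mat(1))
        then have "B1 = 0\<^sub>m s s"
          using GL_inv_cancel(1)[OF A1(1) Bb(1)] GL_inv(1)[OF A1(1)] by simp
        then show "A \<in> ?L \<and> B \<in> ?S"
          using A1 Ab Aeq Beq Bs Bb by (auto intro!: image_eqI[of _ _ "(B2, B4)"])
      next
        assume "A \<in> ?L \<and> B \<in> ?S"
        then obtain A1 C1 D1 B2' B4' where A1: "A1 \<in> GL s" "C1 \<in> carrier_mat t s" "D1 \<in> GL t"
          and Aeq: "A = lower_block s t (A1, C1, D1)"
          and B2': "B2' \<in> carrier_mat s t" "B4' \<in> symm_mats t" "B = four_block_mat (0\<^sub>m s s) B2' (transpose_mat B2') B4'"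
          by auto
        have "B1 = 0\<^sub>m s s"
          using B2' four_block_mat_inject[OF Bb zero_carrier_mat[of s s] B2'(1), of "transpose_mat B2'" B4']
          by (simp add: Beq symm_mats_def)
        then have AB0: "(A * B) $$ (i, j) = 0" if "i < s" "j < s" for i j
          using AB[OF GL_carrier[OF A1(1)] A1(2) GL_carrier[OF A1(3)] Aeq that] GL_carrier[OF A1(1)] that by simp
        have A0: "A $$ (i, j) = 0" if "i < s" "s \<le> j" "j < ?n" for i j
          using index_lower_block[OF GL_carrier[OF A1(1)] GL_carrier[OF A1(3)], of i j C1] that by (simp add: Aeq)
        \<comment> \<open>The inverse of a block lower triangular matrix has the same shape, so its
          transpose vanishes in the opposite corner.\<close>
        have "?D $$ (i, j) = 0" if "s \<le> i" "i < ?n" "j < s" for i j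
        proof -
          have "?D $$ (i, j) = GL_inv ?n A $$ (j, i)" using that GL_inv(1)[OF A] by simp
          also have "\<dots> = 0"
            unfolding Aeq GL_inv_lower_block[OF A1]
            using index_lower_block[OF GL_inv(1)[OF A1(1)] GL_inv(1)[OF A1(3)]] that by simp
          finally show ?thesis .
        qed
        then show "\<forall>i<?n. \<forall>j<?n. (if i < s then (if j < s then (A * B) $$ (i, j) else A $$ (i, j))
          else if j < s then ?D $$ (i, j) else 0) = 0"
          using AB0 A0 by (simp del: index_mult_mat(1))
      qed
    qed
    finally show ?thesis by simp
  qed
  have sub: "A \<in> GL ?n \<and> B \<in> symm_mats ?n" if "A \<in> ?L" "B \<in> ?S" for A B
  proof
    show "A \<in> GL ?n"
      using that(1) by (auto simp: lower_block_GL_iff GL_carrier)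
    show "B \<in> symm_mats ?n"
    proof -
      note B_mem = that(2)
      obtain B' D' where B': "B' \<in> carrier_mat s t" and D': "D' \<in> symm_mats t"
        and B: "B = four_block_mat (0\<^sub>m s s) B' (transpose_mat B') D'"
        using B_mem by auto
      have "D' \<in> carrier_mat t t" using D' by (simp add: symm_mats_def)
      then show ?thesis
        unfolding B using symm_mats_block[OF zero_carrier_mat B', of "transpose_mat B'" D'] B' D'
        by (simp add: symm_mats_def)
    qed
  qed
  show ?thesis
  proof (intro equalityI subsetI)
    fix w assume w: "w \<in> ?K"
    then obtain A B where "A \<in> GL ?n" "B \<in> symm_mats ?n" "w = ?f (A, B)" by (auto simp: parabolic_eq)
    then show "w \<in> ?f ` (?L \<times> ?S)" using mem w by blast
  next
    fix w assume "w \<in> ?f ` (?L \<times> ?S)"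
    then obtain A B where "A \<in> ?L" "B \<in> ?S" "w = ?f (A, B)" by (elim imageE SigmaE) blast
    then show "w \<in> ?K" using mem sub by blast
  qed
qed

text \<open>One factor \<open>CARD('a) ^ (s * t)\<close> counts the block \<open>C\<close> of
  \<open>A\<close>, the other the off-diagonal block of \<open>B\<close>.\<close>

lemma card_sigma_conj_stabilizer:
  assumes two: "(1::'a::{field,finite}) + 1 = 0"
  shows "card {w \<in> parabolic (s + t). sigma (s + t) s * w * sigma (s + t) s \<in> (parabolic (s + t) :: 'a mat set)} =
    card (GL s :: 'a mat set) * card (GL t :: 'a mat set) * card (symm_mats t :: 'a mat set) *
      (CARD('a) ^ (s * t) * CARD('a) ^ (s * t))"
proof -
  let ?L = "lower_block s t ` (GL s \<times> carrier_mat t s \<times> (GL t :: 'a mat set))"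
  let ?h = "\<lambda>(B, D). four_block_mat (0\<^sub>m s s) B (transpose_mat B) D :: 'a mat"
  let ?S = "?h ` (carrier_mat s t \<times> symm_mats t)"
  have "inj_on (lower_block s t) (GL s \<times> carrier_mat t s \<times> (GL t :: 'a mat set))"
    by (rule inj_on_subset[OF inj_on_lower_block]) (auto simp: GL_carrier)
  then have L: "card ?L = card (GL s :: 'a mat set) * (CARD('a) ^ (t * s) * card (GL t :: 'a mat set))"
    by (simp add: card_image card_cartesian_product card_carrier_mat)
  have block: "bij_betw (\<lambda>(A, B, D). four_block_mat A B (transpose_mat B) D)
    (symm_mats s \<times> carrier_mat s t \<times> symm_mats t) (symm_mats (s + t) :: 'a mat set)"
    by (rule bij_betw_symm_mats_block)
  have zero: "0\<^sub>m s s \<in> (symm_mats s :: 'a mat set)" by (simp add: symm_mats_def)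
  \<comment> \<open>Fixing the first block to zero restricts the three-block parametrization of
    symmetric matrices, so injectivity is inherited.\<close>
  have "inj_on ?h (carrier_mat s t \<times> symm_mats t)"
  proof (rule inj_onI)
    fix x y assume "x \<in> carrier_mat s t \<times> symm_mats t" "y \<in> carrier_mat s t \<times> symm_mats t" "?h x = ?h y"
    then show "x = y"
      using inj_onD[OF bij_betw_imp_inj_on[OF block], of "(0\<^sub>m s s, x)" "(0\<^sub>m s s, y)"] zero
      by (auto simp: case_prod_unfold)
  qed
  then have S: "card ?S = CARD('a) ^ (s * t) * card (symm_mats t :: 'a mat set)"
    by (simp add: card_image card_cartesian_product card_carrier_mat)
  have "?L \<times> ?S \<subseteq> GL (s + t) \<times> symm_mats (s + t)"
  proof (rule Sigma_mono)
    show "?L \<subseteq> GL (s + t)" by (auto simp: lower_block_GL_iff GL_carrier)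
    show "?S \<subseteq> symm_mats (s + t)"
    proof
      fix M assume "M \<in> ?S"
      then obtain B D where "B \<in> carrier_mat s t" "D \<in> symm_mats t" "M = ?h (B, D)" by blast
      then show "M \<in> symm_mats (s + t)"
        using bij_betwE[OF block] zero by (metis (mono_tags, lifting) SigmaI case_prod_conv)
    qed
  qed
  then have "card ((\<lambda>(A, B). parabolic_elt (s + t) A B) ` (?L \<times> ?S)) = card ?L * card ?S"
    by (simp add: card_image[OF inj_on_subset[OF inj_on_parabolic_elt]] card_cartesian_product)
  then show ?thesis
    unfolding sigma_conj_stabilizer[OF two] by (simp only: L S) (simp add: algebra_simps)
qed

text \<open>The double coset identity with all counts inserted. The square arises because symmetric
  matrices are counted once in the order of \<open>P\<close> and once in the character sum; one
  power \<open>q ^ (s * t)\<close> common to both sides is cancelled.\<close>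

lemma sum_double_coset:
  fixes \<psi> :: "'a::{field,finite} \<Rightarrow> complex"
  assumes two: "(1::'a) + 1 = 0" and \<psi>: "additive_character \<psi>" "nontrivial_character \<psi>"
  defines "q \<equiv> CARD('a)"
  shows "of_nat (card (GL s :: 'a mat set) * card (GL t :: 'a mat set) * card (symm_mats t :: 'a mat set) * q ^ (s * t)) *
      (\<Sum>w\<in>double_coset (s + t) s. \<psi> (mat_trace w)) =
    of_nat (card (GL (s + t) :: 'a mat set) * (card (symm_mats (s + t) :: 'a mat set))\<^sup>2 * card (alt_GL s :: 'a mat set)) *
      kloosterman_GL t \<psi> 1"
proof -
  let ?n = "s + t" and ?\<sigma> = "sigma (s + t) s :: 'a mat"
  interpret group "GL_group TYPE('a) (?n + ?n)" by (rule group_GL_group)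
  have sq: "?\<sigma> * ?\<sigma> = 1\<^sub>m (?n + ?n)" by (rule sigma_sq) simp
  have \<sigma>: "?\<sigma> \<in> GL (?n + ?n)" by (rule GL_inv_eqI(1)[OF _ _ sq]) (simp_all add: sigma_carrier)
  have inv: "inv\<^bsub>GL_group TYPE('a) (?n + ?n)\<^esub> ?\<sigma> = ?\<sigma>"
    by (rule inv_equality) (simp_all add: GL_group_simps \<sigma> sq)
  have "of_nat (card {w \<in> parabolic ?n. ?\<sigma> * w * ?\<sigma> \<in> parabolic ?n}) *
      (\<Sum>w\<in>double_coset ?n s. \<psi> (mat_trace w)) =
    of_nat (card (parabolic ?n :: 'a mat set)) * (\<Sum>w\<in>parabolic ?n. \<psi> (mat_trace (w * ?\<sigma>)))"
    using double_coset_sum[OF subgroup_parabolic[OF two] finite_parabolic, of ?\<sigma> "\<lambda>w. \<psi> (mat_trace w)"] \<sigma>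
    by (simp add: GL_group_simps inv double_coset_def mat_trace_comm[OF GL_carrier GL_carrier] del: assoc_mult_mat)
  then have "of_nat (q ^ (s * t)) * (of_nat (card (GL s :: 'a mat set) * card (GL t :: 'a mat set) * card (symm_mats t :: 'a mat set) * q ^ (s * t)) *
      (\<Sum>w\<in>double_coset ?n s. \<psi> (mat_trace w))) =
    of_nat (q ^ (s * t)) * (of_nat (card (GL ?n :: 'a mat set) * (card (symm_mats ?n :: 'a mat set))\<^sup>2 * card (alt_GL s :: 'a mat set)) *
      kloosterman_GL t \<psi> 1)"
    unfolding card_sigma_conj_stabilizer[OF two] card_parabolic sum_parabolic_sigma[OF \<psi>] q_def
    by (simp add: power2_eq_square algebra_simps)
  moreover have "of_nat (q ^ (s * t)) \<noteq> (0 :: complex)" by (simp add: q_def)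
  ultimately show ?thesis using mult_left_cancel by blast
qed

section \<open>Kloosterman sums over GL(1) and GL(2)\<close>

lemma character_sum_scaled:
  fixes \<psi> :: "'a::{field,finite} \<Rightarrow> complex"
  assumes \<psi>: "additive_character \<psi>" "nontrivial_character \<psi>"
  shows "(\<Sum>a\<in>UNIV. \<psi> (a * u)) = (if u = 0 then of_nat CARD('a) else 0)"
proof (cases "u = 0")
  case False
  obtain c where c: "\<psi> c \<noteq> 1" using \<psi>(2) by (auto simp: nontrivial_character_def)
  have add: "\<psi> (x + y) = \<psi> x * \<psi> y" for x y using \<psi>(1) by (simp add: additive_character_def)
  have "(\<Sum>a\<in>UNIV. \<psi> (a * u)) = (\<Sum>a\<in>UNIV. \<psi> ((a + c / u) * u))"
    by (rule sum.reindex_bij_witness[where i = "\<lambda>a. a + c / u" and j = "\<lambda>a. a - c / u"]) auto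
  also have "\<dots> = \<psi> c * (\<Sum>a\<in>UNIV. \<psi> (a * u))"
    using False unfolding sum_distrib_left by (intro sum.cong refl) (simp add: distrib_right add)
  finally show ?thesis using c False by simp
qed (simp add: additive_character_zero[OF \<psi>(1)])

lemma kloosterman_GL_1:
  fixes \<psi> :: "'a::{field,finite} \<Rightarrow> complex"
  shows "kloosterman_GL 1 \<psi> 1 = kloosterman \<psi> 1"
  unfolding kloosterman_GL_def kloosterman_def
proof (rule sum.reindex_bij_witness[where j = "\<lambda>M. M $$ (0, 0)" and i = "\<lambda>a. mat 1 1 (\<lambda>_. a)"])
  fix a :: 'a assume a: "a \<in> UNIV - {0}"
  show "mat 1 1 (\<lambda>_. a) \<in> GL 1"
    using a by (simp add: GL_iff_det det_single)
  show "mat 1 1 (\<lambda>_. a) $$ (0, 0) = a" by simp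
next
  fix M :: "'a mat" assume M: "M \<in> GL 1"
  then have Mc: "M \<in> carrier_mat 1 1" by (rule GL_carrier)
  then show "mat 1 1 (\<lambda>_. M $$ (0, 0)) = M" by (intro eq_matI) auto
  have nz: "M $$ (0, 0) \<noteq> 0" using M det_single[OF Mc] by (auto simp: GL_iff_det)
  then show "M $$ (0, 0) \<in> UNIV - {0}" by simp
  have "M * mat 1 1 (\<lambda>_. inverse (M $$ (0, 0))) = 1\<^sub>m 1"
    using Mc nz by (intro eq_matI) (auto simp: scalar_prod_def)
  then have "GL_inv 1 M = mat 1 1 (\<lambda>_. inverse (M $$ (0, 0)))"
    by (intro GL_inv_eqI(2)[OF Mc]) auto
  then show "\<psi> (M $$ (0, 0) + 1 * inverse (M $$ (0, 0))) = \<psi> (mat_trace M + 1 * mat_trace (GL_inv 1 M))"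
    using Mc by (simp add: mat_trace_def)
qed

text \<open>The diagonal entries come first in the tuple because the sum over GL(2) is evaluated
  with the diagonal fixed outermost.\<close>

definition mat22 :: "'a \<times> 'a \<times> 'a \<times> 'a \<Rightarrow> 'a mat" where
  "mat22 = (\<lambda>(a, d, b, c). mat 2 2 (\<lambda>(i, j). if i = 0 then if j = 0 then a else b else if j = 0 then c else d))"

lemma det_mat22: "det (mat22 (a, d, b, c)) = a * d - b * (c :: 'a::idom)"
proof -
  let ?m = "\<lambda>x. mat 1 1 (\<lambda>_. x) :: 'a mat"
  have eq: "mat22 (a, d, b, c) = four_block_mat (?m a) (?m b) (?m c) (?m d)"
    by (intro eq_matI) (auto simp: mat22_def)
  have "det (mat22 (a, d, b, c)) = det (?m a * ?m d - ?m b * ?m c)"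
    unfolding eq by (rule det_four_block_mat) (auto simp: scalar_prod_def mult.commute intro!: eq_matI)
  also have "\<dots> = a * d - b * c"
    by (subst det_single) (auto simp: scalar_prod_def)
  finally show ?thesis .
qed

text \<open>The inverse is the adjugate over the determinant, so the trace of the inverse is trace
  over determinant and each term of the Kloosterman sum depends on these two numbers only.\<close>

lemma trace_inv_mat22:
  fixes a b c d :: "'a::field"
  assumes "a * d - b * c \<noteq> 0"
  shows "mat_trace (GL_inv 2 (mat22 (a, d, b, c))) = (a + d) / (a * d - b * c)"
proof -
  let ?e = "a * d - b * c"
  have "mat22 (a, d, b, c) * mat22 (d / ?e, a / ?e, - b / ?e, - c / ?e) = 1\<^sub>m 2"
    using assms
    by (intro eq_matI) (auto simp: mat22_def scalar_prod_def less_2_cases_iff numeral_2_eq_2 diff_divide_distrib[symmetric]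
        algebra_simps)
  then have "GL_inv 2 (mat22 (a, d, b, c)) = mat22 (d / ?e, a / ?e, - b / ?e, - c / ?e)"
    by (intro GL_inv_eqI(2)) (auto simp: mat22_def)
  then show ?thesis by (simp add: mat22_def mat_trace_def lessThan_Suc numeral_2_eq_2 add_divide_distrib)
qed

lemma bij_betw_mat22: "bij_betw mat22 {(a, d, b, c). a * d - b * c \<noteq> 0} (GL 2 :: 'a::field mat set)"
proof (rule bij_betw_byWitness[where f' = "\<lambda>M. (M $$ (0, 0), M $$ (1, 1), M $$ (0, 1), M $$ (1, 0))"])
  have entries: "mat22 (M $$ (0, 0), M $$ (1, 1), M $$ (0, 1), M $$ (1, 0)) = M" if "M \<in> GL 2" for M :: "'a mat"
    using GL_carrier[OF that] by (intro eq_matI) (auto simp: mat22_def less_2_cases_iff)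
  then show "\<forall>M\<in>GL 2. mat22 (M $$ (0, 0), M $$ (1, 1), M $$ (0, 1), M $$ (1, 0)) = (M :: 'a mat)" by blast
  show "mat22 ` {(a, d, b, c). a * d - b * c \<noteq> 0} \<subseteq> (GL 2 :: 'a mat set)"
    by (auto simp: GL_iff_det det_mat22) (simp_all add: mat22_def)
  show "(\<lambda>M. (M $$ (0, 0), M $$ (1, 1), M $$ (0, 1), M $$ (1, 0))) ` GL 2 \<subseteq> {(a, d, b, c). a * d - b * c \<noteq> (0 :: 'a)}"
  proof
    fix x assume "x \<in> (\<lambda>M. (M $$ (0, 0), M $$ (1, 1), M $$ (0, 1), M $$ (1, 0))) ` (GL 2 :: 'a mat set)"
    then obtain M where M: "M \<in> (GL 2 :: 'a mat set)" and x: "x = (M $$ (0, 0), M $$ (1, 1), M $$ (0, 1), M $$ (1, 0))"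
      by blast
    show "x \<in> {(a, d, b, c). a * d - b * c \<noteq> 0}"
      using det_mat22[of "M $$ (0, 0)" "M $$ (1, 1)" "M $$ (0, 1)" "M $$ (1, 0)"] M
      unfolding entries[OF M] x by (simp add: GL_iff_det)
  qed
qed (auto simp: mat22_def)

lemma kloosterman_GL_2:
  fixes \<psi> :: "'a::{field,finite} \<Rightarrow> complex"
  assumes \<psi>: "additive_character \<psi>" "nontrivial_character \<psi>"
  defines "q \<equiv> of_nat CARD('a) :: complex"
  shows "kloosterman_GL 2 \<psi> 1 = q * ((kloosterman \<psi> 1)\<^sup>2 + q\<^sup>2 - q)"
proof -
  have add: "\<psi> (x + y) = \<psi> x * \<psi> y" for x y using \<psi>(1) by (simp add: additive_character_def)
  \<comment> \<open>The contribution of a matrix with trace \<open>t\<close> and determinant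
    \<open>e\<close>. The value 0 at \<open>e = 0\<close> allows the sum to run over all quadruples,
    singular ones included.\<close>
  define h where "h t e = (if e = 0 then 0 else \<psi> (t + t / e))" for t e
  have fixed_diagonal: "(\<Sum>b\<in>UNIV. \<Sum>c\<in>UNIV. h t (m - b * c)) = q * h t m + (q - 1) * (\<Sum>e\<in>UNIV. h t e)" for t m
  proof -
    have "(\<Sum>c\<in>UNIV. h t (m - b * c)) = (\<Sum>e\<in>UNIV. h t e)" if "b \<noteq> 0" for b
      by (rule sum.reindex_bij_witness[where i = "\<lambda>e. (m - e) / b" and j = "\<lambda>c. m - b * c"]) (use that in auto)
    then have "(\<Sum>b\<in>UNIV. \<Sum>c\<in>UNIV. h t (m - b * c)) = (\<Sum>c\<in>UNIV. h t (m - 0 * c)) + (\<Sum>b\<in>UNIV - {0::'a}. \<Sum>e\<in>UNIV. h t e)"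
      by (subst sum.remove[of _ 0]) (auto intro!: sum.cong)
    then show ?thesis by (simp add: q_def)
  qed
  have all_det: "(\<Sum>a\<in>UNIV. \<Sum>d\<in>UNIV. \<Sum>e\<in>UNIV. h (a + d) e) = q\<^sup>2"
  proof -
    have "(\<Sum>a\<in>UNIV. \<Sum>d\<in>UNIV. \<Sum>e\<in>UNIV. h (a + d) e) = (\<Sum>e\<in>UNIV. \<Sum>a\<in>UNIV. \<Sum>d\<in>UNIV. h (a + d) e)"
    proof -
      have "(\<Sum>a\<in>UNIV. \<Sum>d\<in>UNIV. \<Sum>e\<in>UNIV. h (a + d) e) = (\<Sum>a\<in>UNIV. \<Sum>e\<in>UNIV. \<Sum>d\<in>UNIV. h (a + d) e)"
        by (intro sum.cong refl sum.swap)
      also have "\<dots> = (\<Sum>e\<in>UNIV. \<Sum>a\<in>UNIV. \<Sum>d\<in>UNIV. h (a + d) e)"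
        by (rule sum.swap)
      finally show ?thesis .
    qed
    \<comment> \<open>For nonzero \<open>e\<close> the sum over \<open>a\<close> and
      \<open>d\<close> is the square of a complete character sum with multiplier
      \<open>1 + 1 / e\<close>. By orthogonality only \<open>e = - 1\<close> contributes.\<close>
    also have "\<dots> = (\<Sum>e\<in>(UNIV :: 'a set). if e = - 1 then q\<^sup>2 else 0)"
    proof (rule sum.cong[OF refl])
      fix e :: 'a
      show "(\<Sum>a\<in>UNIV. \<Sum>d\<in>UNIV. h (a + d) e) = (if e = - 1 then q\<^sup>2 else 0)"
      proof (cases "e = 0")
        case False
        have "h (a + d) e = \<psi> (a * (1 + 1 / e)) * \<psi> (d * (1 + 1 / e))" for a d
          using False by (simp add: h_def add[symmetric] add_divide_distrib algebra_simps)
        then have "(\<Sum>a\<in>UNIV. \<Sum>d\<in>UNIV. h (a + d) e) = (\<Sum>a\<in>UNIV. \<psi> (a * (1 + 1 / e)))\<^sup>2"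
          by (simp add: power2_eq_square sum_product)
        moreover have "1 + 1 / e = 0 \<longleftrightarrow> e = - 1"
          using False by (simp add: field_simps eq_neg_iff_add_eq_0)
        ultimately show ?thesis
          unfolding character_sum_scaled[OF \<psi>] by (simp add: q_def)
      qed (simp add: h_def)
    qed
    finally show ?thesis by simp
  qed
  have diag_det: "(\<Sum>a\<in>UNIV. \<Sum>d\<in>UNIV. h (a + d) (a * d)) = (kloosterman \<psi> 1)\<^sup>2"
  proof -
    define k where "k a = (if a = 0 then 0 else \<psi> (a + inverse a))" for a
    \<comment> \<open>Because \<open>(a + d) / (a * d) = 1 / a + 1 / d\<close>, the term splits into
      a factor in \<open>a\<close> and one in \<open>d\<close>; both conventions give 0 when
      \<open>a\<close> or \<open>d\<close> is zero.\<close>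
    have "h (a + d) (a * d) = k a * k d" for a d
      by (simp add: h_def k_def add[symmetric] field_simps)
    then have "(\<Sum>a\<in>UNIV. \<Sum>d\<in>UNIV. h (a + d) (a * d)) = (\<Sum>a\<in>UNIV. k a)\<^sup>2"
      by (simp add: power2_eq_square sum_product)
    also have "(\<Sum>a\<in>UNIV. k a) = (\<Sum>a\<in>UNIV - {0}. k a)"
      by (rule sum.mono_neutral_right) (auto simp: k_def)
    also have "\<dots> = kloosterman \<psi> 1"
      unfolding kloosterman_def by (intro sum.cong) (auto simp: k_def)
    finally show ?thesis .
  qed
  have "kloosterman_GL 2 \<psi> 1 = (\<Sum>x\<in>{(a, d, b, c). a * d - b * c \<noteq> 0}. \<psi> (mat_trace (mat22 x) + 1 * mat_trace (GL_inv 2 (mat22 x))))"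
    unfolding kloosterman_GL_def by (rule sum.reindex_bij_betw[OF bij_betw_mat22, symmetric])
  also have "\<dots> = (\<Sum>(a, d, b, c)\<in>{(a, d, b, c). a * d - b * c \<noteq> 0}. h (a + d) (a * d - b * c))"
    by (intro sum.cong refl)
      (auto simp: trace_inv_mat22 h_def, simp add: mat22_def mat_trace_def lessThan_Suc numeral_2_eq_2 add.commute)
  also have "\<dots> = (\<Sum>(a, d, b, c)\<in>UNIV. h (a + d) (a * d - b * c))"
    by (rule sum.mono_neutral_left) (auto simp: h_def)
  also have "\<dots> = (\<Sum>a\<in>UNIV. \<Sum>d\<in>UNIV. \<Sum>b\<in>UNIV. \<Sum>c\<in>UNIV. h (a + d) (a * d - b * c))"
    by (simp add: sum.cartesian_product case_prod_unfold flip: UNIV_Times_UNIV)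
  also have "\<dots> = (\<Sum>a\<in>UNIV. \<Sum>d\<in>UNIV. q * h (a + d) (a * d) + (q - 1) * (\<Sum>e\<in>UNIV. h (a + d) e))"
    by (simp only: fixed_diagonal)
  also have "\<dots> = q * (kloosterman \<psi> 1)\<^sup>2 + (q - 1) * q\<^sup>2"
    unfolding sum.distrib sum_distrib_left[symmetric] diag_det all_det ..
  finally show ?thesis by (simp add: algebra_simps power2_eq_square)
qed

section \<open>Characteristic two and the final constants\<close>

lemma char_two:
  assumes "CARD('a::{field,finite}) = 2 ^ r"
  shows "(1 :: 'a) + 1 = 0"
proof -
  \<comment> \<open>The sum of all field elements is invariant under translation by 1, so the field
    size is zero in the field.\<close>
  have "(\<Sum>x\<in>UNIV. x) = (\<Sum>x\<in>UNIV. x + (1 :: 'a))"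
    by (rule sum.reindex_bij_witness[where i = "\<lambda>x. x + 1" and j = "\<lambda>x. x - 1"]) auto
  also have "\<dots> = (\<Sum>x\<in>UNIV. x) + of_nat CARD('a)"
    by (simp add: sum.distrib)
  finally have "of_nat CARD('a) = (0 :: 'a)" by simp
  then have "(2 :: 'a) ^ r = 0" by (simp add: assms)
  then have "(2 :: 'a) = 0" by simp
  then show ?thesis by simp
qed

lemma card_GL_0: "card (GL 0 :: 'a::{field,finite} mat set) = 1"
proof -
  have "GL 0 = (carrier_mat 0 0 :: 'a mat set)" by (auto simp: GL_iff_det)
  then show ?thesis using card_carrier_mat(2)[of 0 0, where ?'a = 'a] by simp
qed

lemma card_alt_GL_even:
  "card (alt_GL (2 * m) :: 'a::{field,finite} mat set) =
    CARD('a) ^ (m * (m - 1)) * (\<Prod>j=1..m. CARD('a) ^ (2 * j - 1) - 1)"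
proof (induction m)
  case 0
  have "alt_GL 0 = (carrier_mat 0 0 :: 'a mat set)" by (auto simp: alt_GL_def alt_mats_def GL_iff_det)
  then show ?case using card_carrier_mat(2)[of 0 0, where ?'a = 'a] by simp
next
  case (Suc m)
  \<comment> \<open>The recursion contributes the exponent \<open>2 * m\<close> at this step, and 0
    + 2 + ... + 2(m - 1) is \<open>m * (m - 1)\<close>.\<close>
  have e: "Suc m * (Suc m - 1) = m * (m - 1) + 2 * m"
    by (cases m) (auto simp: algebra_simps)
  have "2 * Suc m = 2 * m + 2" "2 * Suc m - 1 = 2 * m + 1" by simp_all
  then show ?case
    unfolding e power_add by (simp only: card_alt_GL_add_2 Suc.IH prod.cl_ivl_Suc) simp
qed

text \<open>Final cancellation with all powers kept opaque. For \<open>n = 2 m + 1\<close> read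
  \<open>g\<close> as the order of GL(2m), \<open>x\<close> as q, \<open>y\<close> as q^(2m),
  \<open>t\<close> as q^n - 1, \<open>a\<close> as the squared number of symmetric matrices,
  \<open>b * P\<close> as the number of nonsingular alternating ones, and \<open>e\<close> as the
  power of q in \<open>A_minus\<close>.\<close>

lemma cancel_minus:
  fixes x :: "'a::field"
  assumes "g * (x - 1) * x * y * S = t * (y * g) * a * (b * P) * K" "a * b = e * x"
    and nz: "g \<noteq> 0" "x \<noteq> 0" "x - 1 \<noteq> 0" "y \<noteq> 0"
  shows "S = e * (t / (x - 1)) * P * K"
proof -
  have "(g * y * x) * ((x - 1) * S) = g * (x - 1) * x * y * S"
    by (simp only: ac_simps)
  also have "\<dots> = (g * y * t * P * K) * (a * b)"
    unfolding assms(1) by (simp only: ac_simps)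
  also have "\<dots> = (g * y * x) * (t * e * P * K)"
    unfolding assms(2) by (simp only: ac_simps)
  finally have "(g * y * x) * ((x - 1) * S) = (g * y * x) * (t * e * P * K)" .
  then have "(x - 1) * S = t * e * P * K" using nz by simp
  then have "S = (t * e * P * K) / (x - 1)" using nz(3) by (simp add: nonzero_eq_divide_eq mult.commute)
  then show ?thesis by (simp add: divide_inverse ac_simps)
qed

text \<open>The counterpart for \<open>n = 2 m + 2\<close>: \<open>c * (x * d)\<close> is the order
  of GL(2), \<open>x ^ 3\<close> the number of symmetric 2 x 2 matrices, \<open>z\<close> is q^(4m),
  and \<open>t\<close>, \<open>u\<close>, \<open>y\<close>, \<open>y'\<close> come from applying the
  recursion for the order of GL twice. The \<open>inverse x\<close> is what the powers of q leave
  over.\<close>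

lemma cancel_plus:
  fixes x :: "'a::field"
  assumes "g * (c * (x * d)) * x ^ 3 * z * S = t * (y * (u * (y' * g))) * a * (b * P) * K"
    "a * b = e * x\<^sup>2" "y * y' = x * z"
    and nz: "g \<noteq> 0" "x \<noteq> 0" "c \<noteq> 0" "d \<noteq> 0" "z \<noteq> 0"
  shows "S = inverse x * (e * (t * u / (c * d)) * P) * K"
proof -
  have "(g * z * x ^ 3) * (x * (c * d) * S) = g * (c * (x * d)) * x ^ 3 * z * S"
    by (simp only: ac_simps)
  also have "\<dots> = (g * t * u * P * K) * (a * b) * (y * y')"
    unfolding assms(1) by (simp only: ac_simps)
  also have "\<dots> = (g * z * x ^ 3) * (t * u * e * P * K)"
    unfolding assms(2,3) by (simp add: power2_eq_square power3_eq_cube ac_simps)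
  finally have "(g * z * x ^ 3) * (x * (c * d) * S) = (g * z * x ^ 3) * (t * u * e * P * K)" .
  then have "x * (c * d) * S = t * u * e * P * K" using nz by simp
  then have "S = (t * u * e * P * K) / (x * (c * d))" using nz by (simp add: nonzero_eq_divide_eq mult.commute)
  then show ?thesis by (simp add: divide_inverse ac_simps)
qed

lemma sum_DC_minus:
  fixes \<psi> :: "'a::{field,finite} \<Rightarrow> complex"
  assumes two: "(1::'a) + 1 = 0" and \<psi>: "additive_character \<psi>" "nontrivial_character \<psi>" and n: "odd n"
  shows "(\<Sum>w\<in>DC_minus n. \<psi> (mat_trace w)) = of_real (A_minus n CARD('a)) * kloosterman \<psi> 1"
proof -
  obtain m where m: "n = 2 * m + 1" using n by (auto elim: oddE)
  let ?q = "CARD('a)" and ?x = "of_nat CARD('a) :: complex"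
  let ?S = "\<Sum>w\<in>DC_minus n. \<psi> (mat_trace w)" and ?K = "kloosterman \<psi> 1"
  let ?\<Pi> = "\<Prod>j=1..m. ?x ^ (2 * j - 1) - 1"
  let ?G = "of_nat (card (GL (2 * m) :: 'a mat set)) :: complex"
  have q: "?q \<ge> 2" using card_mono[of UNIV "{0, 1 :: 'a}"] by simp
  \<comment> \<open>The counts use truncated subtraction on naturals; this turns them into
    differences of complex numbers.\<close>
  have pow: "of_nat (?q ^ k - 1) = ?x ^ k - 1" for k using q by (simp add: of_nat_diff)
  have x0: "?x \<noteq> 0" "?x - 1 \<noteq> 0" using q by auto
  have G0: "?G \<noteq> 0" using one_GL[of "2 * m"] finite_GL[of "2 * m", where ?'a = 'a] by (auto simp: card_eq_0_iff)
  have GL1: "of_nat (card (GL 1 :: 'a mat set)) = ?x - 1"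
    using card_GL_Suc[of 0, where ?'a = 'a] pow[of 1] card_GL_0[where ?'a = 'a] by simp
  have GLn: "of_nat (card (GL (2 * m + 1) :: 'a mat set)) = (?x ^ n - 1) * (?x ^ (2 * m) * ?G)"
    using card_GL_Suc[of "2 * m", where ?'a = 'a] pow[of n] by (simp add: m)
  have sym1: "card (symm_mats 1 :: 'a mat set) = ?q" using card_symm_mats[of 1, where ?'a = 'a] by simp
  have symn: "(card (symm_mats n :: 'a mat set))\<^sup>2 = ?q ^ ((2 * m + 1) * (2 * m + 2))"
  proof -
    have "n * (n + 1) div 2 * 2 = (2 * m + 1) * (2 * m + 2)" by (simp add: m)
    then show ?thesis by (metis card_symm_mats power_mult)
  qed
  have alt: "of_nat (card (alt_GL (2 * m) :: 'a mat set)) = ?x ^ (m * (m - 1)) * ?\<Pi>"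
    unfolding card_alt_GL_even by (simp only: of_nat_mult of_nat_prod pow of_nat_power)
  have "?G * (?x - 1) * ?x * ?x ^ (2 * m) * ?S =
      (?x ^ n - 1) * (?x ^ (2 * m) * ?G) * ?x ^ ((2 * m + 1) * (2 * m + 2)) * (?x ^ (m * (m - 1)) * ?\<Pi>) * ?K"
    using sum_double_coset[OF two \<psi>, of "2 * m" 1] GL1 GLn symn[unfolded m] alt
    by (simp only: of_nat_mult of_nat_power sym1 kloosterman_GL_1 DC_minus_def m mult_1_right diff_add_inverse2)
  moreover
  \<comment> \<open>The origin of the exponent in \<open>A_minus\<close>: squared symmetric matrices
    plus alternating matrices. The extra 1 is used up by the q symmetric 1 x 1 matrices on the
    left.\<close>
  have "(2 * m + 1) * (2 * m + 2) + m * (m - 1) = (5 * n\<^sup>2 - 1) div 4 + 1"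
  proof -
    have "m * m - m = m * (m - 1)" "m \<le> m * m" by (simp_all add: algebra_simps)
    moreover have "5 * n\<^sup>2 - 1 = 4 * (5 * (m * m) + 5 * m + 1)" by (simp add: m power2_eq_square algebra_simps)
    ultimately show ?thesis by (simp add: algebra_simps)
  qed
  then have "?x ^ ((2 * m + 1) * (2 * m + 2)) * ?x ^ (m * (m - 1)) = ?x ^ ((5 * n\<^sup>2 - 1) div 4) * ?x"
    by (simp only: power_add[symmetric]) (simp only: power_add power_one_right)
  ultimately have "?S = ?x ^ ((5 * n\<^sup>2 - 1) div 4) * ((?x ^ n - 1) / (?x - 1)) * ?\<Pi> * ?K"
    using G0 x0 by (intro cancel_minus[where x = ?x and g = ?G and y = "?x ^ (2 * m)"]) auto
  then show ?thesis
    by (simp add: A_minus_def gauss_binomial_def m)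
qed

lemma sum_DC_plus:
  fixes \<psi> :: "'a::{field,finite} \<Rightarrow> complex"
  assumes two: "(1::'a) + 1 = 0" and \<psi>: "additive_character \<psi>" "nontrivial_character \<psi>" and n: "even n" "2 \<le> n"
  shows "(\<Sum>w\<in>DC_plus n. \<psi> (mat_trace w)) =
    inverse (of_nat CARD('a)) * of_real (A_plus n CARD('a)) * kloosterman_GL 2 \<psi> 1"
proof -
  obtain k where "n = 2 * k" using n(1) by (rule evenE)
  then obtain m where m: "n = 2 * m + 2" using n(2) by (cases k) auto
  let ?q = "CARD('a)" and ?x = "of_nat CARD('a) :: complex"
  let ?S = "\<Sum>w\<in>DC_plus n. \<psi> (mat_trace w)" and ?K = "kloosterman_GL 2 \<psi> 1"
  let ?\<Pi> = "\<Prod>j=1..m. ?x ^ (2 * j - 1) - 1"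
  let ?G = "of_nat (card (GL (2 * m) :: 'a mat set)) :: complex"
  have q: "?q \<ge> 2" using card_mono[of UNIV "{0, 1 :: 'a}"] by simp
  have pow: "of_nat (?q ^ k - 1) = ?x ^ k - 1" for k using q by (simp add: of_nat_diff)
  have "of_nat (?q ^ k - 1) \<noteq> (0 :: complex)" if "k > 0" for k
    using q that one_less_power[of ?q k] by (simp del: of_nat_diff)
  then have x0: "?x \<noteq> 0" "?x - 1 \<noteq> 0" "?x\<^sup>2 - 1 \<noteq> 0" using q pow[of 1] pow[of 2] by (fastforce, fastforce, fastforce)
  have G0: "?G \<noteq> 0" using one_GL[of "2 * m"] finite_GL[of "2 * m", where ?'a = 'a] by (auto simp: card_eq_0_iff)
  have GL2: "of_nat (card (GL 2 :: 'a mat set)) = (?x\<^sup>2 - 1) * (?x * (?x - 1))"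
    using card_GL_Suc[of 1, where ?'a = 'a] card_GL_Suc[of 0, where ?'a = 'a] pow[of 1] pow[of 2] card_GL_0[where ?'a = 'a]
    by (simp add: numeral_2_eq_2)
  have GLn: "of_nat (card (GL (2 * m + 2) :: 'a mat set)) =
      (?x ^ n - 1) * (?x ^ (2 * m + 1) * ((?x ^ (n - 1) - 1) * (?x ^ (2 * m) * ?G)))"
    using card_GL_Suc[of "2 * m", where ?'a = 'a] card_GL_Suc[of "2 * m + 1", where ?'a = 'a] pow[of n] pow[of "n - 1"]
    by (simp add: m)
  have sym2: "card (symm_mats 2 :: 'a mat set) = ?q ^ 3" using card_symm_mats[of 2, where ?'a = 'a] by simp
  have symn: "(card (symm_mats n :: 'a mat set))\<^sup>2 = ?q ^ ((2 * m + 2) * (2 * m + 3))"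
  proof -
    have "n * (n + 1) div 2 * 2 = (2 * m + 2) * (2 * m + 3)" by (simp add: m algebra_simps)
    then show ?thesis by (metis card_symm_mats power_mult)
  qed
  have alt: "of_nat (card (alt_GL (2 * m) :: 'a mat set)) = ?x ^ (m * (m - 1)) * ?\<Pi>"
    unfolding card_alt_GL_even by (simp only: of_nat_mult of_nat_prod pow of_nat_power)
  let ?T = "(?x ^ n - 1) * (?x ^ (n - 1) - 1)"
  have "?G * ((?x\<^sup>2 - 1) * (?x * (?x - 1))) * ?x ^ 3 * ?x ^ (2 * m * 2) * ?S =
      (?x ^ n - 1) * (?x ^ (2 * m + 1) * ((?x ^ (n - 1) - 1) * (?x ^ (2 * m) * ?G))) *
        ?x ^ ((2 * m + 2) * (2 * m + 3)) * (?x ^ (m * (m - 1)) * ?\<Pi>) * ?K"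
    using sum_double_coset[OF two \<psi>, of "2 * m" 2] GL2 GLn symn[unfolded m] alt
    by (simp only: of_nat_mult of_nat_power sym2 DC_plus_def m diff_add_inverse2)
  \<comment> \<open>The exponent of \<open>A_plus\<close> plus 2. On the left there remain q^3 from
    the symmetric 2 x 2 matrices, q from GL(2) and q^(4m), against q^(4m + 1) from GL(n); the net
    q^(2 - 3) is the factor 1/q of the result.\<close>
  moreover have "(2 * m + 2) * (2 * m + 3) + m * (m - 1) = (5 * n\<^sup>2 - 2 * n) div 4 + 2"
  proof -
    have "m * m - m = m * (m - 1)" "m \<le> m * m" by (simp_all add: algebra_simps)
    moreover have "5 * n\<^sup>2 - 2 * n = 4 * (5 * (m * m) + 9 * m + 4)" by (simp add: m power2_eq_square algebra_simps)
    ultimately show ?thesis by (simp add: algebra_simps)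
  qed
  then have "?x ^ ((2 * m + 2) * (2 * m + 3)) * ?x ^ (m * (m - 1)) = ?x ^ ((5 * n\<^sup>2 - 2 * n) div 4) * ?x\<^sup>2"
    by (simp only: power_add[symmetric])
  moreover have "?x ^ (2 * m + 1) * ?x ^ (2 * m) = ?x * ?x ^ (2 * m * 2)"
    by (simp flip: power_add)
  ultimately have "?S = inverse ?x * (?x ^ ((5 * n\<^sup>2 - 2 * n) div 4) * (?T / ((?x\<^sup>2 - 1) * (?x - 1))) * ?\<Pi>) * ?K"
    using G0 x0 by (intro cancel_plus[where x = ?x and g = ?G and z = "?x ^ (2 * m * 2)"]) auto
  moreover have "gauss_binomial ?q n 2 =
      (real ?q ^ n - 1) * (real ?q ^ (n - 1) - 1) / ((real ?q ^ 2 - 1) * (real ?q - 1))"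
    by (simp add: gauss_binomial_def numeral_2_eq_2)
  moreover have "(n - 2) div 2 = m" by (simp add: m)
  ultimately show ?thesis by (simp add: A_plus_def)
qed

theorem theorem4:
  fixes \<psi> :: "'a::{field,finite} \<Rightarrow> complex" and q r n :: nat
  assumes "q = CARD('a)" and "q = 2 ^ r"
    and "additive_character \<psi>" and "nontrivial_character \<psi>"
  shows "(odd n \<longrightarrow>
            (\<Sum>w\<in>DC_minus n. \<psi> (mat_trace w)) = of_real (A_minus n q) * kloosterman \<psi> 1) \<and>
         (even n \<and> 2 \<le> n \<longrightarrow>
            (\<Sum>w\<in>DC_plus n. \<psi> (mat_trace w))
              = inverse (of_nat q) * of_real (A_plus n q) * kloosterman_GL 2 \<psi> 1 \<and>
            inverse (of_nat q) * of_real (A_plus n q) * kloosterman_GL 2 \<psi> 1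
              = of_real (A_plus n q) * ((kloosterman \<psi> 1)\<^sup>2 + of_nat q ^ 2 - of_nat q))"
proof -
  have two: "(1::'a) + 1 = 0" using char_two assms(1,2) by blast
  \<comment> \<open>The evaluation of the GL(2) sum carries a factor q, which cancels the
    inverse.\<close>
  have "inverse (of_nat q) * of_real (A_plus n q) * kloosterman_GL 2 \<psi> 1
      = of_real (A_plus n q) * ((kloosterman \<psi> 1)\<^sup>2 + of_nat q ^ 2 - of_nat q)"
    unfolding kloosterman_GL_2[OF assms(3,4)] assms(1) by simp
  then show ?thesis
    using sum_DC_minus[OF two assms(3,4)] sum_DC_plus[OF two assms(3,4)] assms(1) by blast
qed

end
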